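(* For every positive integer $t$ there exists a graph $G$ with thickness $\theta(G)=3$ and geometric thickness $\bar\theta(G)\ge t$.
   Context: The thickness $\theta(G)$ of a graph $G$ is the minimum number $k$ such that $G$ can be drawn in the plane with vertices at fixed distinct points and edges drawn as curves (arbitrary bends allowed), with each edge assigned to one of $k$ layers so that no two edges in the same layer cross; equivalently, the minimum number of planar subgraphs into which the edge set of $G$ can be partitioned. The geometric thickness $\bar\theta(G)$ is the minimum $k$ such that $G$ has such a drawing in which every edge is a straight line segment between its endpoints, with each edge assigned to one of $k$ layers and no two edges of the same layer crossing. *)

theory Defs
  imports "HOL-Analysis.Analysis"
begin

definition simple_graph :: "'a set \<Rightarrow> 'a set set \<Rightarrow> bool" where
  "simple_graph V E \<longleftrightarrow> finite V \<and> (\<forall>e\<in>E. e \<subseteq> V \<and> card e = 2)"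

text \<open>The plane is \<^typ>\<open>complex\<close>, as in the library's Jordan curve theorem. The edge \<open>e\<close> is drawn as
  the curve \<open>c e\<close>, whose orientation is irrelevant. As usual for drawings, an edge contains no
  vertex besides its own two endpoints.\<close>

definition drawing ::
  "'a set \<Rightarrow> 'a set set \<Rightarrow> ('a \<Rightarrow> complex) \<Rightarrow> ('a set \<Rightarrow> real \<Rightarrow> complex) \<Rightarrow> bool" where
  "drawing V E p c \<longleftrightarrow>
     inj_on p V \<and>
     (\<forall>e\<in>E. arc (c e) \<and> {pathstart (c e), pathfinish (c e)} = p ` e \<and>
            path_image (c e) \<inter> p ` V = p ` e)"

text \<open>Two edges cross if they share a point that is not a common endpoint.\<close>

definition crossing ::
  "('a \<Rightarrow> complex) \<Rightarrow> ('a set \<Rightarrow> real \<Rightarrow> complex) \<Rightarrow> 'a set \<Rightarrow> 'a set \<Rightarrow> bool" where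
  "crossing p c e f \<longleftrightarrow> \<not> path_image (c e) \<inter> path_image (c f) \<subseteq> p ` (e \<inter> f)"

definition layered_drawing ::
  "'a set \<Rightarrow> 'a set set \<Rightarrow> nat \<Rightarrow> ('a \<Rightarrow> complex) \<Rightarrow> ('a set \<Rightarrow> real \<Rightarrow> complex)
     \<Rightarrow> ('a set \<Rightarrow> nat) \<Rightarrow> bool" where
  "layered_drawing V E k p c layer \<longleftrightarrow>
     drawing V E p c \<and>
     (\<forall>e\<in>E. layer e < k) \<and>
     (\<forall>e\<in>E. \<forall>f\<in>E. e \<noteq> f \<and> layer e = layer f \<longrightarrow> \<not> crossing p c e f)"

definition straight_line ::
  "'a set set \<Rightarrow> ('a \<Rightarrow> complex) \<Rightarrow> ('a set \<Rightarrow> real \<Rightarrow> complex) \<Rightarrow> bool" where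
  "straight_line E p c \<longleftrightarrow>
     (\<forall>u v. {u, v} \<in> E \<longrightarrow> path_image (c {u, v}) = closed_segment (p u) (p v))"

text \<open>On natural numbers the infimum of a nonempty set is its minimum, and \<open>Inf {} = 0\<close>; a positive
  lower bound on either parameter therefore also asserts that a drawing exists.\<close>

definition thickness :: "'a set \<Rightarrow> 'a set set \<Rightarrow> nat" where
  "thickness V E = Inf {k. \<exists>p c layer. layered_drawing V E k p c layer}"

definition geometric_thickness :: "'a set \<Rightarrow> 'a set set \<Rightarrow> nat" where
  "geometric_thickness V E =
     Inf {k. \<exists>p c layer. layered_drawing V E k p c layer \<and> straight_line E p c}"

end

theory Submission
  imports Defs "HOL-Library.Ramsey"
begin

text \<open>
  The graph is Eppstein's: base vertices \<open>0, \<dots>, n - 1\<close>, and for every triple \<open>i < j < k\<close> of them an apex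
  joined to \<open>i\<close>, \<open>j\<close> and \<open>k\<close>. Putting the edges to the smallest, middle and largest base vertex of each
  triple into separate layers makes every layer a star forest, so three layers suffice. With two layers
  every apex has two edges in one layer, and for large \<open>n\<close> Ramsey's theorem yields a subdivided
  \<open>K\<^sub>3\<^sub>,\<^sub>3\<close> in a single layer, which the Jordan curve theorem rules out.

  Now let a straight-line drawing with at most \<open>t\<close> layers be given. Perturb it into general position
  and use Ramsey's theorem to find seven base vertices such that the layers of the edges and the
  orientations of the triples of points depend only on the relative order of the indices involved. The
  seven points are then in convex position, and edges to, say, the smallest vertices of two triples lie
  in the same layer, hence do not cross. The three-term Grassmann-Pluecker relations for the
  orientations contradict this.
\<close>

section \<open>Nonplanarity of the complete bipartite graph\<close>

text \<open>The inside and the outside of the curve are open, connected and disjoint, and a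
  connected subset of the complement cannot meet both. So they are exactly the components, and each
  has the whole curve as frontier.\<close>

lemma Jordan_component:
  fixes c :: "real \<Rightarrow> complex"
  assumes c: "simple_path c" "pathfinish c = pathstart c" and z: "z \<notin> path_image c"
  shows "frontier (connected_component_set (- path_image c) z) = path_image c"
    and "\<exists>w. w \<notin> path_image c \<and> \<not> connected_component (- path_image c) z w"
proof -
  obtain I U where J: "I \<noteq> {}" "open I" "connected I" "U \<noteq> {}" "open U" "connected U"
      "frontier I = path_image c" "frontier U = path_image c"
    and IO: "I \<inter> U = {}" "I \<union> U = - path_image c"
    using Jordan_curve[OF c] by metis
  have comp: "connected_component_set (- path_image c) x = S"
    if S: "S = I \<or> S = U" and x: "x \<in> S" for x S
  proof (rule connected_component_unique)
    show "x \<in> S" by fact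
    show "connected S" using S J by auto
    show "S \<subseteq> - path_image c" using S IO by blast
    show "T \<subseteq> S" if T: "x \<in> T" "T \<subseteq> - path_image c" "connected T" for T
    proof -
      have "I \<inter> U \<inter> T = {}" "T \<subseteq> I \<union> U"
        using T IO by auto
      then have "I \<inter> T = {} \<or> U \<inter> T = {}"
        using connectedD[OF T(3) J(2,5)] by blast
      then show ?thesis
        using S T(1) x \<open>T \<subseteq> I \<union> U\<close> by auto
    qed
  qed
  obtain S S' where S: "S = I \<and> S' = U \<or> S = U \<and> S' = I" "z \<in> S"
  proof -
    have "z \<in> I \<or> z \<in> U" using z IO(2) by blast
    then show thesis using that by metis
  qed
  then have S': "connected_component_set (- path_image c) z = S" "frontier S = path_image c" "S' \<noteq> {}"
    using comp J by auto
  have S'': "S \<inter> S' = {}" "S' \<subseteq> - path_image c"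
    using S(1) IO by blast+
  show "frontier (connected_component_set (- path_image c) z) = path_image c"
    using S' by simp
  obtain w where "w \<in> S'" using S' by blast
  then show "\<exists>w. w \<notin> path_image c \<and> \<not> connected_component (- path_image c) z w"
    using S' S'' by (intro exI[of _ w]) auto
qed

text \<open>The first arc followed by the reversed second one is a simple closed curve.\<close>

lemma Jordan_two_arcs:
  fixes c d :: "real \<Rightarrow> complex"
  assumes "arc c" "arc d" "pathstart c = a" "pathfinish c = b" "pathstart d = a" "pathfinish d = b"
    and "path_image c \<inter> path_image d = {a, b}" and z: "z \<notin> path_image c \<union> path_image d"
  shows "frontier (connected_component_set (- (path_image c \<union> path_image d)) z)
           = path_image c \<union> path_image d"
    and "\<exists>w. w \<notin> path_image c \<union> path_image d \<and>
             \<not> connected_component (- (path_image c \<union> path_image d)) z w"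
proof -
  have "simple_path (c +++ reversepath d)"
    using assms by (intro simple_path_join_loop) (auto simp: arc_reversepath)
  moreover have "pathfinish (c +++ reversepath d) = pathstart (c +++ reversepath d)"
    using assms by simp
  moreover have "path_image (c +++ reversepath d) = path_image c \<union> path_image d"
    using assms by (simp add: path_image_join)
  ultimately show "frontier (connected_component_set (- (path_image c \<union> path_image d)) z)
           = path_image c \<union> path_image d"
    and "\<exists>w. w \<notin> path_image c \<union> path_image d \<and>
             \<not> connected_component (- (path_image c \<union> path_image d)) z w"
    using Jordan_component[of "c +++ reversepath d" z] z by auto
qed

text \<open>Take \<open>w\<close> separated from \<open>z\<close> by the closed curve
  \<open>S1 \<union> S2\<close>. Neither of the other two closed curves separates these points, and
  the two curves meet in the connected set \<open>S3\<close>. By Janiszewski's theorem their union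
  does not separate the points either, a contradiction.\<close>

lemma theta_curve_separates:
  fixes c1 c2 c3 :: "real \<Rightarrow> complex"
  assumes arcs: "arc c1" "arc c2" "arc c3"
    and ends: "pathstart c1 = a" "pathfinish c1 = b" "pathstart c2 = a" "pathfinish c2 = b"
      "pathstart c3 = a" "pathfinish c3 = b"
    and meet: "path_image c1 \<inter> path_image c2 = {a, b}" "path_image c1 \<inter> path_image c3 = {a, b}"
      "path_image c2 \<inter> path_image c3 = {a, b}"
    and y: "y1 \<in> path_image c1 - {a, b}" "y2 \<in> path_image c2 - {a, b}" "y3 \<in> path_image c3 - {a, b}"
    and z: "z \<notin> path_image c1 \<union> path_image c2 \<union> path_image c3"
    and con1: "connected_component (- (path_image c2 \<union> path_image c3)) z y1"
    and con2: "connected_component (- (path_image c1 \<union> path_image c3)) z y2"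
    and con3: "connected_component (- (path_image c1 \<union> path_image c2)) z y3"
  shows False
proof -
  define S1 S2 S3 where S: "S1 = path_image c1" "S2 = path_image c2" "S3 = path_image c3"
  note J12 = Jordan_two_arcs[OF arcs(1,2) ends(1-4) meet(1), folded S]
    and J13 = Jordan_two_arcs[OF arcs(1,3) ends(1,2,5,6) meet(2), folded S]
    and J23 = Jordan_two_arcs[OF arcs(2,3) ends(3-6) meet(3), folded S]
  obtain w where w: "w \<notin> S1 \<union> S2" "\<not> connected_component (- (S1 \<union> S2)) z w"
    using J12(2)[of z] z S by blast
  have ab: "a \<in> S1" "b \<in> S1" "a \<in> S2" "b \<in> S2" "a \<in> S3" "b \<in> S3"
    using meet S by auto
  have con: "connected (path_image c - {a, b})" if "arc c" "pathstart c = a" "pathfinish c = b" for c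
    using connected_simple_path_endless[OF arc_imp_simple_path, of c] that by simp
  \<comment> \<open>An arc without its ends is connected, so reaching one of its inner points means
    reaching all of them.\<close>
  have same: "connected_component T z x"
    if T: "connected_component T z y" and "x \<in> path_image c - {a, b}" "y \<in> path_image c - {a, b}"
      "path_image c - {a, b} \<subseteq> T" "arc c" "pathstart c = a" "pathfinish c = b" for T x y c
  proof -
    have "connected_component T y x"
      unfolding connected_component_def using that con[of c] by blast
    with T show ?thesis by (rule connected_component_trans)
  qed
  have S1z: "connected_component (- (S2 \<union> S3)) z x" if "x \<in> S1 - {a, b}" for x
    unfolding S by (rule same[OF con1, of _ c1]) (use that y meet arcs ends S in auto)
  have S2z: "connected_component (- (S1 \<union> S3)) z x" if "x \<in> S2 - {a, b}" for x
    unfolding S by (rule same[OF con2, of _ c2]) (use that y meet arcs ends S in auto)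
  have S3z: "connected_component (- (S1 \<union> S2)) z x" if "x \<in> S3 - {a, b}" for x
    unfolding S by (rule same[OF con3, of _ c3]) (use that y meet arcs ends S in auto)
  have w3: "w \<notin> S3" using S3z[of w] w ab by blast
  let ?W = "\<lambda>C. connected_component_set (- C) w"
  \<comment> \<open>A component of the complement of one of the three closed curves that does not contain \<open>z\<close> misses
    the whole theta curve. Hence two such components that meet are equal, which is absurd as
    they have different frontiers.\<close>
  have miss: "?W (A \<union> B) \<inter> D = {}"
    if w: "\<not> connected_component (- (A \<union> B)) z w"
      and D: "\<And>x. x \<in> D - {a, b} \<Longrightarrow> connected_component (- (A \<union> B)) z x"
      and "a \<in> A" "b \<in> A" for A B D
  proof -
    have "x \<notin> D" if x: "connected_component (- (A \<union> B)) w x" for x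
    proof
      assume "x \<in> D"
      moreover have "x \<notin> A"
        using connected_component_in[OF x] by auto
      ultimately have "connected_component (- (A \<union> B)) z x"
        using \<open>a \<in> A\<close> \<open>b \<in> A\<close> by (intro D) auto
      then show False
        using w x connected_component_sym connected_component_trans by metis
    qed
    then show ?thesis by auto
  qed
  have incl: "?W C \<subseteq> ?W D" if "?W C \<inter> D = {}" "w \<notin> C" for C D
    using that by (intro connected_component_maximal) auto
  have W12: "?W (S1 \<union> S2) \<inter> S3 = {}" 
    using w S3z ab by (intro miss) auto
  have sub: "?W C \<inter> C = {}" for C using connected_component_subset by fastforce
  have con13: "connected_component (- (S1 \<union> S3)) z w"
  proof (rule ccontr)
    assume n: "\<not> ?thesis"
    have "?W (S1 \<union> S3) \<inter> S2 = {}" using n S2z ab by (intro miss) auto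
    then have "?W (S1 \<union> S3) = ?W (S1 \<union> S2)"
      using W12 sub[of "S1 \<union> S2"] sub[of "S1 \<union> S3"] w w3 by (intro equalityI incl) blast+
    then have "S1 \<union> S3 = S1 \<union> S2"
      using J12(1)[of w] J13(1)[of w] w w3 by auto
    then show False using y meet S by blast
  qed
  have con23: "connected_component (- (S2 \<union> S3)) z w"
  proof (rule ccontr)
    assume n: "\<not> ?thesis"
    have "?W (S2 \<union> S3) \<inter> S1 = {}" using n S1z ab by (intro miss) auto
    then have "?W (S2 \<union> S3) = ?W (S1 \<union> S2)"
      using W12 sub[of "S1 \<union> S2"] sub[of "S2 \<union> S3"] w w3 by (intro equalityI incl) blast+
    then have "S2 \<union> S3 = S1 \<union> S2"
      using J12(1)[of w] J23(1)[of w] w w3 by auto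
    then show False using y meet S by blast
  qed
  have "connected_component (- ((S1 \<union> S3) \<union> (S2 \<union> S3))) z w"
  proof (rule Janiszewski[OF _ _ _ con13 con23])
    show "compact (S1 \<union> S3)" "closed (S2 \<union> S3)"
      using arcs S by (auto intro: compact_Un closed_Un compact_arc_image closed_arc_image)
    have "(S1 \<union> S3) \<inter> (S2 \<union> S3) = S3" using meet ab S by auto
    then show "connected ((S1 \<union> S3) \<inter> (S2 \<union> S3))"
      using arcs S connected_arc_image by auto
  qed
  then have "connected_component (- (S1 \<union> S2)) z w"
    by (rule connected_component_of_subset) blast
  then show False using w by blast
qed

text \<open>The paths from \<open>x 0\<close> through \<open>y j\<close> to \<open>x 1\<close> form
  a theta curve, and the edges at \<open>x 2\<close> lead to the inner point \<open>y j\<close> of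
  each path while avoiding the other two paths.\<close>

lemma K33_nonplanar:
  fixes x y :: "nat \<Rightarrow> complex" and g :: "nat \<Rightarrow> nat \<Rightarrow> real \<Rightarrow> complex"
  assumes arc: "\<And>i j. i < 3 \<Longrightarrow> j < 3 \<Longrightarrow> arc (g i j)"
    and ends: "\<And>i j. i < 3 \<Longrightarrow> j < 3 \<Longrightarrow> pathstart (g i j) = x i"
      "\<And>i j. i < 3 \<Longrightarrow> j < 3 \<Longrightarrow> pathfinish (g i j) = y j"
    and disj: "\<And>i j k l. \<lbrakk>i < 3; j < 3; k < 3; l < 3; i \<noteq> k; j \<noteq> l\<rbrakk> \<Longrightarrow>
      path_image (g i j) \<inter> path_image (g k l) = {}"
    and meet_x: "\<And>i j l. \<lbrakk>i < 3; j < 3; l < 3; j \<noteq> l\<rbrakk> \<Longrightarrow>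
      path_image (g i j) \<inter> path_image (g i l) = {x i}"
    and meet_y: "\<And>i j k. \<lbrakk>i < 3; j < 3; k < 3; i \<noteq> k\<rbrakk> \<Longrightarrow>
      path_image (g i j) \<inter> path_image (g k j) = {y j}"
  shows False
proof -
  define c where "c j = g 0 j +++ reversepath (g 1 j)" for j
  define G where "G i j = path_image (g i j)" for i j
  have xG: "x i \<in> G i j" and yG: "y j \<in> G i j" and ne: "x i \<noteq> y j" if "i < 3" "j < 3" for i j
    using ends[OF that] pathstart_in_path_image[of "g i j"] pathfinish_in_path_image[of "g i j"]
      arc_distinct_ends[OF arc[OF that]] by (auto simp: G_def)
  note D = disj[folded G_def] meet_x[folded G_def] meet_y[folded G_def]
  have D0: "G 0 j \<inter> G 1 l = {}" "G 2 j \<inter> G 0 l = {}" "G 2 j \<inter> G 1 l = {}" 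
     "G 0 j \<inter> G 0 l = {x 0}" "G 1 j \<inter> G 1 l = {x 1}" if "j < 3" "l < 3" "j \<noteq> l" for j l
    using that D by auto
  have D1: "G 0 j \<inter> G 1 j = {y j}" "G 2 j \<inter> G 0 j = {y j}" "G 2 j \<inter> G 1 j = {y j}" if "j < 3" for j
    using that D by auto
  have im: "path_image (c j) = G 0 j \<union> G 1 j" if "j < 3" for j
    using ends[of 0 j] ends[of 1 j] that by (simp add: c_def path_image_join G_def)
  have carc: "arc (c j)" if "j < 3" for j
    unfolding c_def
    using that ends[of 0 j] ends[of 1 j] arc[of 0 j] arc[of 1 j] D1(1)[of j]
    by (intro arc_join) (auto simp: arc_reversepath G_def)
  have cends: "pathstart (c j) = x 0" "pathfinish (c j) = x 1" if "j < 3" for j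
    using that ends[of 0 j] ends[of 1 j] by (auto simp: c_def)
  have cmeet: "path_image (c j) \<inter> path_image (c l) = {x 0, x 1}" if "j < 3" "l < 3" "j \<noteq> l" for j l
  proof -
    have "G 0 j \<inter> G 1 l = {}" "G 1 j \<inter> G 0 l = {}" using D0[of j l] D0[of l j] that by auto
    then show ?thesis using D0(4,5)[OF that] im that by auto
  qed
  have z: "x 2 \<notin> path_image (c j)" if "j < 3" for j
  proof -
    \<comment> \<open>An edge at \<open>x 2\<close> that does not end in \<open>y j\<close> is
      disjoint from both edges that make up \<open>c j\<close>.\<close>
    define k :: nat where "k = (if j = 0 then 1 else 0)"
    then have "k < 3" "k \<noteq> j" by auto
    then show ?thesis using xG[of 2 k] D0(2,3)[of k j] im that by auto
  qed
  have y: "y j \<in> path_image (c j) - {x 0, x 1}" if "j < 3" for j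
    using yG[of 0 j] ne[of 0 j] ne[of 1 j] that by (auto simp: im)
  have con: "connected_component (- (path_image (c k) \<union> path_image (c l))) (x 2) (y j)"
    if "j < 3" "k < 3" "l < 3" "j \<noteq> k" "j \<noteq> l" for j k l
    unfolding connected_component_def
  proof (intro exI[of _ "G 2 j"] conjI)
    show "connected (G 2 j)" using connected_arc_image[OF arc[of 2 j]] that by (simp add: G_def)
    show "G 2 j \<subseteq> - (path_image (c k) \<union> path_image (c l))"
      using D0(2,3)[of j k] D0(2,3)[of j l] im that by auto
    show "x 2 \<in> G 2 j" "y j \<in> G 2 j" using xG yG that by auto
  qed
  show False
    by (rule theta_curve_separates[OF carc carc carc cends cends cends cmeet cmeet cmeet y y y _ con con con,
          of 0 1 2]) (use z in auto)
qed

section \<open>Order-invariant colourings\<close>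

text \<open>The order pattern of a list, equalities included: lists of the same length have equal
  \<open>ranks\<close> iff corresponding pairs of entries compare alike. Counting in
  \<open>remdups xs\<close> instead of a set lets the simplifier evaluate it.\<close>

definition ranks :: "nat list \<Rightarrow> nat list" where
  "ranks xs = map (\<lambda>x. length (filter (\<lambda>y. y < x) (remdups xs))) xs"

lemma length_ranks [simp]: "length (ranks xs) = length xs"
  by (simp add: ranks_def)

lemma ranks_conv_card: "ranks xs = map (\<lambda>x. card {y \<in> set xs. y < x}) xs"
proof -
  have "length (filter (\<lambda>y. y < x) (remdups xs)) = card {y \<in> set xs. y < x}" for x
    using distinct_card[of "filter (\<lambda>y. y < x) (remdups xs)"] by (simp add: set_filter conj_commute)
  then show ?thesis by (simp add: ranks_def)
qed

lemma ranks_map_strict_mono: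
  assumes "strict_mono_on (set xs) f"
  shows "ranks (map f xs) = ranks xs"
proof -
  have "card {y \<in> f ` set xs. y < f x} = card {y \<in> set xs. y < x}" if "x \<in> set xs" for x
  proof (rule bij_betw_same_card[symmetric], rule bij_betw_imageI)
    show "inj_on f {y \<in> set xs. y < x}"
      using strict_mono_on_imp_inj_on[OF assms] by (rule inj_on_subset) auto
    show "f ` {y \<in> set xs. y < x} = {y \<in> f ` set xs. y < f x}"
      using strict_mono_on_less[OF assms _ that] by auto
  qed
  then show ?thesis by (simp add: ranks_conv_card)
qed

text \<open>Serves to pad lists to the fixed length that a colouring expects: a repeated entry adds
  no new value, so all counts stay.\<close>

lemma ranks_snoc_nth:
  assumes "i < length xs"
  shows "ranks (xs @ [xs ! i]) = ranks xs @ [ranks xs ! i]"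
proof -
  have "set (xs @ [xs ! i]) = set xs" using assms by auto
  then show ?thesis using assms by (simp add: ranks_conv_card)
qed

lemma sorted_list_of_set_nth_card:
  fixes S :: "'a :: linorder set"
  assumes "finite S" "x \<in> S"
  shows "sorted_list_of_set S ! card {y \<in> S. y < x} = x"
proof -
  let ?l = "sorted_list_of_set S"
  have set: "set ?l = S" using assms by simp
  then obtain i where i: "i < length ?l" "?l ! i = x"
    using assms(2) in_set_conv_nth[of x ?l] by auto
  have lt: "?l ! j < ?l ! k" if "j < k" "k < length ?l" for j k
    using sorted_wrt_nth_less[OF strict_sorted_list_of_set that] .
  have mono: "?l ! j < ?l ! k \<longleftrightarrow> j < k" if "j < length ?l" "k < length ?l" for j k
    using lt[of j k] lt[of k j] that by (cases j k rule: linorder_cases) auto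
  have "{y \<in> S. y < x} = (!) ?l ` {..<i}"
  proof (intro set_eqI iffI)
    fix y assume "y \<in> {y \<in> S. y < x}"
    then obtain j where "j < length ?l" "?l ! j = y" "y < x"
      using in_set_conv_nth[of y ?l] set by auto
    then show "y \<in> (!) ?l ` {..<i}" using mono[of j i] i by auto
  next
    fix y assume "y \<in> (!) ?l ` {..<i}"
    then obtain j where j: "j < i" "y = ?l ! j" by auto
    then have "y \<in> set ?l" using i by simp
    then show "y \<in> {y \<in> S. y < x}" using mono[of j i] i j assms by auto
  qed
  moreover have "inj_on ((!) ?l) {..<i}"
    using i by (intro inj_on_nth) auto
  ultimately have "card {y \<in> S. y < x} = i"
    by (simp add: card_image)
  then show ?thesis using i by simp
qed

text \<open>The elements of \<open>S\<close> outside the list lie above it and do not affect the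
  counts, so a rank is the position of the entry in the sorted list of \<open>S\<close>.\<close>

lemma map_nth_ranks:
  assumes "finite S" "set xs \<subseteq> S" "\<And>x y. x \<in> set xs \<Longrightarrow> y \<in> S - set xs \<Longrightarrow> x < y"
  shows "map ((!) (sorted_list_of_set S)) (ranks xs) = xs"
proof -
  have "sorted_list_of_set S ! card {y \<in> set xs. y < x} = x" if "x \<in> set xs" for x
  proof -
    have "{y \<in> set xs. y < x} = {y \<in> S. y < x}" using assms that by (auto dest: less_asym)
    then show ?thesis using sorted_list_of_set_nth_card[of S x] assms that by auto
  qed
  then show ?thesis by (simp add: ranks_conv_card map_idI)
qed

text \<open>Each \<open>m\<close>-set is coloured by the whole table of colours that
  \<open>c\<close> gives to the lists over it, indexed by order pattern. Ramsey's theorem makes this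
  table constant on a set of \<open>n + m\<close> elements.\<close>

theorem Ramsey_order_invariant:
  fixes C :: "'c set" and m n :: nat
  assumes "finite C"
  shows "\<exists>N. \<forall>c. (\<forall>xs. c xs \<in> C) \<longrightarrow>
     (\<exists>H\<subseteq>{..<N}. card H = n \<and>
       (\<forall>xs ys. set xs \<subseteq> H \<longrightarrow> set ys \<subseteq> H \<longrightarrow> length xs = m \<longrightarrow> ranks xs = ranks ys \<longrightarrow> c xs = c ys))"
proof -
  define L where "L = {r. set r \<subseteq> {..<m} \<and> length r = m}"
  have "finite L" unfolding L_def by (rule finite_lists_length_eq) simp
  \<comment> \<open>The finitely many colour tables, numbered by \<open>e\<close> below because
    \<open>partn_lst\<close> has numbers as colours.\<close>
  define F where "F = L \<rightarrow>\<^sub>E C"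
  have "finite F" unfolding F_def using \<open>finite L\<close> assms by (intro finite_PiE) auto
  then obtain e :: "(nat list \<Rightarrow> 'c) \<Rightarrow> nat" where e: "bij_betw e F {..<card F}"
    using ex_bij_betw_finite_nat[of F] by (auto simp: atLeast0LessThan)
  obtain N :: nat where N: "partn_lst {..<N} (replicate (card F) (n + m)) m"
    using ramsey_full by blast
  show ?thesis
  proof (intro exI[of _ N] allI impI)
    fix c :: "nat list \<Rightarrow> 'c" assume c: "\<forall>xs. c xs \<in> C"
    \<comment> \<open>A pattern \<open>r\<close> is read as a list of positions in the sorted list
      of \<open>S\<close>.\<close>
    define col where "col S = (\<lambda>r\<in>L. c (map ((!) (sorted_list_of_set S)) r))" for S
    have colF: "col S \<in> F" for S using c by (auto simp: col_def F_def)
    then have "e \<circ> col \<in> nsets {..<N} m \<rightarrow> {..<card F}"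
      using e by (auto simp: bij_betw_def)
    then obtain i H' where H': "H' \<in> nsets {..<N} (n + m)" "(e \<circ> col) ` nsets H' m \<subseteq> {i}"
      using partn_lstE[OF N] by (metis length_replicate nth_replicate)
    then have hom: "col S = col T" if "S \<in> nsets H' m" "T \<in> nsets H' m" for S T
    proof -
      have "e (col S) = e (col T)" using that H'(2) by (auto simp: image_subset_iff)
      then show ?thesis using e colF by (auto simp: bij_betw_def dest: inj_onD)
    qed
    have fin: "finite H'" and card: "card H' = n + m" and sub: "H' \<subseteq> {..<N}"
      using H' by (auto simp: nsets_def)
    let ?l = "sorted_list_of_set H'"
    \<comment> \<open>The \<open>n\<close> smallest elements form \<open>H\<close>; the
      \<open>m\<close> largest are kept as a reserve above \<open>H\<close>.\<close>
    define H T where "H = set (take n ?l)" and "T = set (drop n ?l)"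
    have len: "length ?l = n + m" using card by simp
    have H: "card H = n" "card T = m" "H \<union> T = H'"
      using len distinct_sorted_list_of_set[of H'] fin 
      by (auto simp: H_def T_def distinct_card set_append[symmetric] simp del: set_append)
    have less: "x < y" if "x \<in> H" "y \<in> T" for x y
    proof -
      have "sorted_wrt (<) (take n ?l @ drop n ?l)" by simp
      then show ?thesis using that unfolding sorted_wrt_append H_def T_def by blast
    qed
    \<comment> \<open>A list over \<open>H\<close> may have fewer than \<open>m\<close> distinct
      entries. Reserve elements complete them to an \<open>m\<close>-set and, being larger, leave
      the ranks unchanged.\<close>
    have ex: "\<exists>S\<in>nsets H' m. map ((!) (sorted_list_of_set S)) (ranks xs) = xs"
      if xs: "set xs \<subseteq> H" "length xs = m" for xs
    proof -
      have "card (set xs) \<le> m" using xs card_length by metis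
      then obtain T0 where T0: "T0 \<subseteq> T" "card T0 = m - card (set xs)"
        using obtain_subset_with_card_n[of "m - card (set xs)" T] H by (metis diff_le_self)
      have dis: "set xs \<inter> T0 = {}" using xs T0 less by blast
      have S: "finite (set xs \<union> T0)" "set xs \<union> T0 \<subseteq> H'" "finite T0"
        using xs T0 H fin by (auto intro: finite_subset)
      then have "card (set xs \<union> T0) = m"
        using dis T0 \<open>card (set xs) \<le> m\<close> by (simp add: card_Un_disjoint)
      moreover have "map ((!) (sorted_list_of_set (set xs \<union> T0))) (ranks xs) = xs"
        using S less xs T0 by (intro map_nth_ranks) auto
      ultimately show ?thesis using S by (intro bexI[of _ "set xs \<union> T0"]) (auto simp: nsets_def)
    qed
    have L: "ranks xs \<in> L" if "length xs = m" for xs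
    proof -
      have "card {y \<in> set xs. y < x} < m" if x: "x \<in> set xs" for x
      proof -
        have "card {y \<in> set xs. y < x} < card (set xs)"
          using x by (intro psubset_card_mono) auto
        then show ?thesis using card_length[of xs] \<open>length xs = m\<close> by linarith
      qed
      then show ?thesis using that by (auto simp: L_def ranks_conv_card)
    qed
    show "\<exists>H\<subseteq>{..<N}. card H = n \<and>
       (\<forall>xs ys. set xs \<subseteq> H \<longrightarrow> set ys \<subseteq> H \<longrightarrow> length xs = m \<longrightarrow> ranks xs = ranks ys \<longrightarrow> c xs = c ys)"
    proof (intro exI[of _ H] conjI allI impI)
      show "H \<subseteq> {..<N}" "card H = n" using H sub by auto
      fix xs ys assume *: "set xs \<subseteq> H" "set ys \<subseteq> H" "length xs = m" "ranks xs = ranks ys"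
      then have "length ys = m" by (metis length_ranks)
      then obtain S S' where S: "S \<in> nsets H' m" "map ((!) (sorted_list_of_set S)) (ranks xs) = xs"
        "S' \<in> nsets H' m" "map ((!) (sorted_list_of_set S')) (ranks ys) = ys"
        using ex * by metis
      have "c xs = col S (ranks xs)" using S L[of xs] * by (simp add: col_def)
      also have "\<dots> = col S' (ranks ys)" using hom[OF S(1,3)] * by simp
      also have "\<dots> = c ys" using S L[of ys] \<open>length ys = m\<close> by (simp add: col_def)
      finally show "c xs = c ys" .
    qed
  qed
qed

section \<open>Orientations of point triples\<close>

text \<open>Twice the signed area of the triangle, positive iff \<open>a\<close>, \<open>b\<close>,
  \<open>c\<close> run counterclockwise.\<close>

definition orient :: "complex \<Rightarrow> complex \<Rightarrow> complex \<Rightarrow> real" where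
  "orient a b c = (Re b - Re a) * (Im c - Im a) - (Im b - Im a) * (Re c - Re a)"

lemma orient_rotate: "orient a b c = orient b c a"
  by (simp add: orient_def algebra_simps)

lemma orient_swap: "orient a c b = - orient a b c"
  by (simp add: orient_def algebra_simps)

lemma orient_Grassmann_Pluecker:
  "orient a b c * orient a d e - orient a b d * orient a c e + orient a b e * orient a c d = 0"
  by (simp add: orient_def algebra_simps)

text \<open>The map \<open>orient c d\<close> is affine along the segment from \<open>a\<close> to
  \<open>b\<close> and changes sign, so it vanishes at the parameter \<open>s\<close>;
  \<open>u\<close> arises symmetrically. Both parameters give the intersection point of the two
  lines.\<close>

lemma segments_meet_if_orient_alternate:
  assumes "orient a b c * orient a b d < 0" and "orient c d a * orient c d b < 0"
  shows "closed_segment a b \<inter> closed_segment c d \<noteq> {}"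
proof -
  define s where "s = orient c d a / (orient c d a - orient c d b)"
  define u where "u = orient a b c / (orient a b c - orient a b d)"
  have ne: "orient c d a - orient c d b \<noteq> 0" "orient a b c - orient a b d \<noteq> 0"
    using assms by (auto simp: mult_less_0_iff)
  have neg: "orient c d a - orient c d b = - (orient a b c - orient a b d)"
    by (simp add: orient_def algebra_simps)
  have range: "0 \<le> x / (x - y) \<and> x / (x - y) \<le> 1" if "x * y < 0" for x y :: real
    using that by (auto simp: mult_less_0_iff divide_simps)
  have eq: "(1 - s) *\<^sub>R a + s *\<^sub>R b = (1 - u) *\<^sub>R c + u *\<^sub>R d"
  proof -
    let ?D = "orient a b c - orient a b d"
    have Ds: "?D * s = - orient c d a" and Du: "?D * u = orient a b c"
      using ne unfolding s_def u_def neg by (simp_all add: field_simps)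
    \<comment> \<open>Multiplication by the common denominator turns each coordinate of the claim
      into a polynomial identity.\<close>
    have lin: "?D * ((1 - r) * x + r * y) = ?D * x + (?D * r) * (y - x)" for r x y :: real
      by (simp add: algebra_simps)
    have "?D * ((1 - s) * Re a + s * Re b) = ?D * ((1 - u) * Re c + u * Re d)"
      unfolding lin Ds Du unfolding orient_def by algebra
    moreover have "?D * ((1 - s) * Im a + s * Im b) = ?D * ((1 - u) * Im c + u * Im d)"
      unfolding lin Ds Du unfolding orient_def by algebra
    ultimately show ?thesis using ne by (simp add: complex_eq_iff)
  qed
  have "(1 - s) *\<^sub>R a + s *\<^sub>R b \<in> closed_segment a b"
    using range[OF assms(2)] unfolding s_def closed_segment_def by blast
  moreover have "(1 - u) *\<^sub>R c + u *\<^sub>R d \<in> closed_segment c d"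
    using range[OF assms(1)] unfolding u_def closed_segment_def by blast
  ultimately show ?thesis using eq by auto
qed

text \<open>The set is a line; its normal \<open>n\<close> is \<open>b - a\<close> turned by a right
  angle.\<close>

lemma negligible_orient_zero:
  assumes "a \<noteq> b"
  shows "negligible {z. orient a b z = 0}"
proof -
  define n where "n = Complex (- (Im b - Im a)) (Re b - Re a)"
  have "n \<noteq> 0" using assms by (auto simp: n_def complex_eq_iff)
  moreover have "orient a b z = n \<bullet> z - n \<bullet> a" for z
    by (simp add: n_def orient_def inner_complex_def algebra_simps)
  ultimately show ?thesis
    using negligible_hyperplane[of n "n \<bullet> a"] by simp
qed

section \<open>Small perturbations of finite point sets\<close>

text \<open>The points are placed one at a time: finitely many lines through points already placed
  are negligible and cannot cover a ball.\<close>

lemma general_position_perturbation: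
  fixes p :: "'a \<Rightarrow> complex"
  assumes "finite V" and \<epsilon>: "\<epsilon> > 0"
  shows "\<exists>q. inj_on q V \<and> (\<forall>v\<in>V. dist (p v) (q v) < \<epsilon>) \<and>
     (\<forall>u\<in>V. \<forall>v\<in>V. \<forall>w\<in>V. u \<noteq> v \<longrightarrow> u \<noteq> w \<longrightarrow> v \<noteq> w \<longrightarrow> orient (q u) (q v) (q w) \<noteq> 0)"
  using \<open>finite V\<close>
proof induction
  case empty
  then show ?case by simp
next
  case (insert x V)
  from insert.IH obtain q where q: "inj_on q V" "\<forall>v\<in>V. dist (p v) (q v) < \<epsilon>"
    and gen: "\<forall>u\<in>V. \<forall>v\<in>V. \<forall>w\<in>V. u \<noteq> v \<longrightarrow> u \<noteq> w \<longrightarrow> v \<noteq> w \<longrightarrow> orient (q u) (q v) (q w) \<noteq> 0"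
    by (elim exE conjE) (rule that)
  define P where "P = {(u, v) \<in> V \<times> V. u \<noteq> v}"
  \<comment> \<open>The placed points are excluded separately to keep \<open>q\<close> injective,
    since a single placed point spans no line.\<close>
  define L where "L = (\<Union>(u, v)\<in>P. {z. orient (q u) (q v) z = 0}) \<union> q ` V"
  have "finite P"
    using insert(1) by (auto simp: P_def intro: finite_subset[of _ "V \<times> V"])
  have "negligible ((\<lambda>(u, v). {z. orient (q u) (q v) z = 0}) e)" if "e \<in> P" for e
    using that inj_onD[OF q(1)] by (auto simp: P_def intro!: negligible_orient_zero)
  then have "negligible (\<Union>(u, v)\<in>P. {z. orient (q u) (q v) z = 0})"
    using \<open>finite P\<close> by (intro negligible_Union) auto
  then have "negligible L"
    unfolding L_def using negligible_finite[of "q ` V"] insert(1) by (intro negligible_Un) auto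
  moreover have "\<not> negligible (ball (p x) \<epsilon>)"
    using \<epsilon> by (simp add: open_not_negligible)
  ultimately have "\<not> ball (p x) \<epsilon> \<subseteq> L"
    using negligible_subset[of L "ball (p x) \<epsilon>"] by blast
  then obtain z where z: "z \<in> ball (p x) \<epsilon>" "z \<notin> L"
    by blast
  have z1: "z \<noteq> q v" if "v \<in> V" for v using z that by (auto simp: L_def)
  have z2: "orient (q u) (q v) z \<noteq> 0" "orient (q u) z (q v) \<noteq> 0" "orient z (q u) (q v) \<noteq> 0"
    if "u \<in> V" "v \<in> V" "u \<noteq> v" for u v
  proof -
    show "orient (q u) (q v) z \<noteq> 0" using z that by (auto simp: L_def P_def)
    then show "orient (q u) z (q v) \<noteq> 0" "orient z (q u) (q v) \<noteq> 0"
      using orient_swap[of "q u" z "q v"] orient_rotate[of z "q u" "q v"] by auto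
  qed
  show ?case
  proof (intro exI[of _ "q(x := z)"] conjI ballI impI)
    show "inj_on (q(x := z)) (insert x V)"
      using q(1) z1 \<open>x \<notin> V\<close> by (auto simp: inj_on_def)
    show "dist (p v) ((q(x := z)) v) < \<epsilon>" if "v \<in> insert x V" for v
      using that q(2) z(1) \<open>x \<notin> V\<close> by auto
    show "orient ((q(x := z)) u) ((q(x := z)) v) ((q(x := z)) w) \<noteq> 0"
      if "u \<in> insert x V" "v \<in> insert x V" "w \<in> insert x V" "u \<noteq> v" "u \<noteq> w" "v \<noteq> w" for u v w
      using that z2 gen \<open>x \<notin> V\<close> by (cases "u = x"; cases "v = x"; cases "w = x") simp_all
  qed
qed

text \<open>Disjoint segments are compact and hence have a positive distance \<delta>; moving the
  endpoints by less than half of it moves every point of a segment by less than half of it.\<close>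

lemma disjoint_segments_stable:
  fixes a b c d :: "'a :: euclidean_space"
  assumes "closed_segment a b \<inter> closed_segment c d = {}"
  shows "\<exists>\<epsilon>>0. \<forall>a' b' c' d'. dist a a' < \<epsilon> \<longrightarrow> dist b b' < \<epsilon> \<longrightarrow> dist c c' < \<epsilon> \<longrightarrow> dist d d' < \<epsilon> \<longrightarrow>
     closed_segment a' b' \<inter> closed_segment c' d' = {}"
proof -
  obtain \<delta> where \<delta>: "\<delta> > 0" "\<And>x y. x \<in> closed_segment a b \<Longrightarrow> y \<in> closed_segment c d \<Longrightarrow> \<delta> \<le> dist x y"
    using separate_compact_closed[OF compact_segment(1) closed_segment(1) assms] by blast
  have near: "\<exists>x\<in>closed_segment a b. dist x z < \<delta> / 2"
    if "z \<in> closed_segment a' b'" "dist a a' < \<delta> / 2" "dist b b' < \<delta> / 2" for a b a' b' z :: 'a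
  proof -
    obtain s where s: "0 \<le> s" "s \<le> 1" "z = (1 - s) *\<^sub>R a' + s *\<^sub>R b'"
      using \<open>z \<in> closed_segment a' b'\<close> by (auto simp: closed_segment_def)
    let ?x = "(1 - s) *\<^sub>R a + s *\<^sub>R b"
    have "?x - z = (1 - s) *\<^sub>R (a - a') + s *\<^sub>R (b - b')"
      using s by (simp add: algebra_simps)
    then have "dist ?x z \<le> (1 - s) * dist a a' + s * dist b b'"
      using norm_triangle_ineq[of "(1 - s) *\<^sub>R (a - a')" "s *\<^sub>R (b - b')"] s
      by (simp add: dist_norm)
    also have "\<dots> < \<delta> / 2"
      using convex_bound_lt[OF that(2,3), of "1 - s" s] s by simp
    finally show ?thesis using s by (auto simp: closed_segment_def)
  qed
  show ?thesis
  proof (intro exI[of _ "\<delta> / 2"] conjI allI impI)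
    fix a' b' c' d' assume *: "dist a a' < \<delta> / 2" "dist b b' < \<delta> / 2" "dist c c' < \<delta> / 2" "dist d d' < \<delta> / 2"
    show "closed_segment a' b' \<inter> closed_segment c' d' = {}"
    proof (rule ccontr)
      assume "\<not> ?thesis"
      then obtain z where z: "z \<in> closed_segment a' b'" "z \<in> closed_segment c' d'" by blast
      obtain x y where "x \<in> closed_segment a b" "dist x z < \<delta> / 2" "y \<in> closed_segment c d" "dist y z < \<delta> / 2"
        using near[OF z(1) *(1,2)] near[OF z(2) *(3,4)] by blast
      then show False using \<delta>(2)[of x y] dist_triangle2[of x y z] by fastforce
    qed
  qed (use \<delta> in auto)
qed

section \<open>Drawings of graphs\<close>

text \<open>The layers may be planned separately, each with its own vertex positions: a homeomorphism of the
  plane then moves the vertices of every layer to common positions.\<close>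

lemma layered_drawing_if_straight_layers:
  fixes V :: "'a set" and P :: "nat \<Rightarrow> 'a \<Rightarrow> complex"
  assumes G: "simple_graph V E" and layer: "\<And>e. e \<in> E \<Longrightarrow> layer e < k"
    and inj: "\<And>l. l < k \<Longrightarrow> inj_on (P l) V"
    and avoid: "\<And>u v. {u, v} \<in> E \<Longrightarrow> closed_segment (P (layer {u, v}) u) (P (layer {u, v}) v) \<inter> P (layer {u, v}) ` V
       \<subseteq> P (layer {u, v}) ` {u, v}"
    and nocross: "\<And>u v u' v'. {u, v} \<in> E \<Longrightarrow> {u', v'} \<in> E \<Longrightarrow> {u, v} \<noteq> {u', v'} \<Longrightarrow>
       layer {u', v'} = layer {u, v} \<Longrightarrow>
       closed_segment (P (layer {u, v}) u) (P (layer {u, v}) v) \<inter> closed_segment (P (layer {u, v}) u') (P (layer {u, v}) v')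
       \<subseteq> P (layer {u, v}) ` ({u, v} \<inter> {u', v'})"
  shows "\<exists>p c. layered_drawing V E k p c layer"
proof -
  have "finite V" using G by (simp add: simple_graph_def)
  obtain p :: "'a \<Rightarrow> complex" where p: "inj_on p V"
    using finite_imp_inj_to_nat_seg[OF \<open>finite V\<close>] inj_of_nat
    by (metis comp_inj_on inj_on_subset top_greatest)
  have "\<exists>f g. homeomorphism UNIV UNIV f g \<and> (\<forall>v\<in>V. f (P l v) = p v)" if "l < k" for l
    by (rule homeomorphism_moving_points_exists[of UNIV UNIV V "P l" p])
      (use \<open>finite V\<close> p inj[OF that] in \<open>auto simp: pairwise_def inj_on_def\<close>)
  then obtain f g where homeo: "\<And>l. l < k \<Longrightarrow> homeomorphism UNIV UNIV (f l) (g l)"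
    and f: "\<And>l v. l < k \<Longrightarrow> v \<in> V \<Longrightarrow> f l (P l v) = p v"
    by metis
  have f_inj: "inj (f l)" and f_cont: "continuous_on UNIV (f l)" if "l < k" for l
    using homeo[OF that] by (auto simp: homeomorphism_def inj_def) metis
  have "\<exists>u v. e = {u, v} \<and> u \<noteq> v \<and> u \<in> V \<and> v \<in> V" if "e \<in> E" for e
  proof -
    have "e \<subseteq> V" "card e = 2" using G that by (auto simp: simple_graph_def)
    then obtain u v where "e = {u, v}" "u \<noteq> v" by (auto simp: card_2_iff)
    then show ?thesis using \<open>e \<subseteq> V\<close> by (intro exI[of _ u] exI[of _ v]) auto
  qed
  then obtain a b where ab: "\<And>e. e \<in> E \<Longrightarrow> e = {a e, b e}" "\<And>e. e \<in> E \<Longrightarrow> a e \<noteq> b e"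
    "\<And>e. e \<in> E \<Longrightarrow> a e \<in> V" "\<And>e. e \<in> E \<Longrightarrow> b e \<in> V"
    by metis
  define s where "s e = closed_segment (P (layer e) (a e)) (P (layer e) (b e))" for e
  \<comment> \<open>Edges of one layer are moved by the same injective map, so they acquire no new
    meeting points. Edges of different layers may meet arbitrarily.\<close>
  define c where "c e = f (layer e) \<circ> linepath (P (layer e) (a e)) (P (layer e) (b e))" for e
  have im: "path_image (c e) = f (layer e) ` s e" for e
    by (simp add: c_def s_def path_image_compose)
  have pe: "f (layer e) ` P (layer e) ` T = p ` T" if "e \<in> E" "T \<subseteq> V" for e T
    using f[OF layer[OF \<open>e \<in> E\<close>]] that by (force simp: image_iff)
  have eV: "e \<subseteq> V" if "e \<in> E" for e
    using G that by (simp add: simple_graph_def)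
  have s_avoid: "s e \<inter> P (layer e) ` V \<subseteq> P (layer e) ` e" if "e \<in> E" for e
    using avoid[of "a e" "b e"] ab(1)[OF that] that by (simp add: s_def)
  have s_nocross: "s e \<inter> s e' \<subseteq> P (layer e) ` (e \<inter> e')"
    if "e \<in> E" "e' \<in> E" "e \<noteq> e'" "layer e' = layer e" for e e'
    using nocross[of "a e" "b e" "a e'" "b e'"] ab(1)[OF that(1)] ab(1)[OF that(2)] that
    by (simp add: s_def)
  have "layered_drawing V E k p c layer"
    unfolding layered_drawing_def drawing_def crossing_def
  proof (intro conjI ballI impI)
    show "inj_on p V" by fact
    fix e assume e: "e \<in> E"
    note l = layer[OF e]
    show "layer e < k" by fact
    have "P (layer e) (a e) \<noteq> P (layer e) (b e)"
      using inj_onD[OF inj[OF l]] ab(2-4)[OF e] by blast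
    then have "arc (linepath (P (layer e) (a e)) (P (layer e) (b e)))" by (rule arc_linepath)
    then show "arc (c e)"
      unfolding c_def arc_def path_def
      using continuous_on_compose2[OF f_cont[OF l]] comp_inj_on[OF _ inj_on_subset[OF f_inj[OF l]]]
      by (auto simp: comp_def)
    have "{pathstart (c e), pathfinish (c e)} = {p (a e), p (b e)}"
      using f[OF l] ab[OF e] by (simp add: c_def pathstart_compose pathfinish_compose)
    then show ends: "{pathstart (c e), pathfinish (c e)} = p ` e"
      using ab(1)[OF e] by (metis image_empty image_insert)
    have "path_image (c e) \<inter> p ` V = f (layer e) ` (s e \<inter> P (layer e) ` V)"
      using pe[OF e, of V] by (simp add: im image_Int[OF f_inj[OF l]])
    also have "\<dots> \<subseteq> f (layer e) ` P (layer e) ` e" using s_avoid[OF e] by blast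
    also have "\<dots> = p ` e" using pe[OF e eV[OF e]] .
    finally have 1: "path_image (c e) \<inter> p ` V \<subseteq> p ` e" .
    have "p ` e \<subseteq> path_image (c e)" unfolding ends[symmetric]
      by (simp add: pathstart_in_path_image pathfinish_in_path_image)
    then show "path_image (c e) \<inter> p ` V = p ` e" using 1 eV[OF e] by blast
    fix e' assume e': "e' \<in> E" "e \<noteq> e' \<and> layer e = layer e'"
    have "path_image (c e) \<inter> path_image (c e') = f (layer e) ` (s e \<inter> s e')"
      using e' image_Int[OF f_inj[OF l]] by (simp add: im)
    also have "\<dots> \<subseteq> f (layer e) ` P (layer e) ` (e \<inter> e')" 
      by (intro image_mono s_nocross) (use e e' in auto)
    also have "\<dots> = p ` (e \<inter> e')" using eV[OF e] by (intro pe[OF e]) auto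
    finally show "\<not> \<not> path_image (c e) \<inter> path_image (c e') \<subseteq> p ` (e \<inter> e')" by simp
  qed
  then show ?thesis by blast
qed

text \<open>Some straight-line drawing exists: vertices on a parabola and a separate layer for every
  edge. So the infimum is taken over a nonempty set and is a minimum.\<close>

lemma geometric_thickness_attained:
  fixes V :: "nat set"
  assumes G: "simple_graph V E"
  shows "\<exists>p c layer. layered_drawing V E (geometric_thickness V E) p c layer \<and> straight_line E p c"
proof -
  define p where "p v = Complex (real v) ((real v)\<^sup>2)" for v
  define c where "c e = linepath (p (Min e)) (p (Max e))" for e
  have fin: "finite E" using G finite_subset[of E "Pow V"] by (auto simp: simple_graph_def)
  \<comment> \<open>As \<open>layer\<close> is injective on the edges, the crossing condition
    becomes vacuous.\<close>
  then obtain layer :: "nat set \<Rightarrow> nat" and k where layer: "inj_on layer E" "layer ` E = {i. i < k}"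
    using finite_imp_inj_to_nat_seg[OF fin] by metis
  have inj: "inj p" by (auto simp: p_def inj_def)
  have seg: "path_image (c {u, v}) = closed_segment (p u) (p v)" for u v
    by (cases "u \<le> v") (auto simp: c_def min_def max_def closed_segment_commute)
  have mid: "w = u \<or> w = v" if w: "p w \<in> closed_segment (p u) (p v)" for u v w
  proof -
    obtain s where s: "0 \<le> s" "s \<le> 1" "p w = (1 - s) *\<^sub>R p u + s *\<^sub>R p v"
      using w by (auto simp: closed_segment_def)
    \<comment> \<open>Strict convexity of the square: a chord meets the parabola only at its
      ends.\<close>
    define x y z where "x = real u" and "y = real v" and "z = real w"
    have "z = (1 - s) * x + s * y" "z\<^sup>2 = (1 - s) * x\<^sup>2 + s * y\<^sup>2"
      using s by (auto simp: p_def x_def y_def z_def complex_eq_iff)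
    then have "s * (1 - s) * (x - y)\<^sup>2 = 0" by algebra
    then have "s = 0 \<or> s = 1 \<or> x = y" by auto
    then show ?thesis using \<open>z = (1 - s) * x + s * y\<close> by (auto simp: x_def y_def z_def algebra_simps)
  qed
  have "layered_drawing V E k p c layer"
    unfolding layered_drawing_def drawing_def crossing_def
  proof (intro conjI ballI impI)
    show "inj_on p V" using inj inj_on_subset by blast
    fix e assume e: "e \<in> E"
    have eV: "e \<subseteq> V" "card e = 2" using G e by (auto simp: simple_graph_def)
    then obtain u v where uv: "e = {u, v}" "u < v"
      using card_2_iff[of e] by (metis insert_commute linorder_neqE_nat)
    have "p u \<noteq> p v" using inj uv by (auto dest: injD)
    then show "arc (c e)" "{pathstart (c e), pathfinish (c e)} = p ` e"
      using uv by (auto simp: c_def intro: arc_linepath)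
    show "path_image (c e) \<inter> p ` V = p ` e"
      using uv eV mid[of _ u v] by (auto simp: seg)
    show "layer e < k" using layer e by auto
    show "\<not> \<not> path_image (c e) \<inter> path_image (c f) \<subseteq> p ` (e \<inter> f)"
      if "f \<in> E" "e \<noteq> f \<and> layer e = layer f" for f
      using that e layer by (auto dest: inj_onD)
  qed
  moreover have "straight_line E p c" by (simp add: straight_line_def seg)
  ultimately have "{k. \<exists>p c layer. layered_drawing V E k p c layer \<and> straight_line E p c} \<noteq> {}"
    by blast
  from Inf_nat_def1[OF this] show ?thesis by (simp add: geometric_thickness_def)
qed

section \<open>The tripod graph\<close>

text \<open>Joining the two edges at each \<open>w i j\<close> gives an arc from
  \<open>p (x i)\<close> to \<open>p (y j)\<close>, and these nine arcs would draw the complete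
  bipartite graph without crossings.\<close>

lemma layer_no_subdivided_K33:
  fixes x y :: "nat \<Rightarrow> 'a" and w :: "nat \<Rightarrow> nat \<Rightarrow> 'a"
  assumes D: "layered_drawing V E k p c layer"
    and edges: "\<And>i j. i < 3 \<Longrightarrow> j < 3 \<Longrightarrow> {x i, w i j} \<in> E \<and> {y j, w i j} \<in> E"
    and layers: "\<And>i j. i < 3 \<Longrightarrow> j < 3 \<Longrightarrow> layer {x i, w i j} = l \<and> layer {y j, w i j} = l"
    and dist: "\<And>i j. \<lbrakk>i < 3; j < 3\<rbrakk> \<Longrightarrow> x i \<noteq> y j"
      "\<And>i j k. \<lbrakk>i < 3; j < 3; k < 3\<rbrakk> \<Longrightarrow> x i \<noteq> w j k"
      "\<And>i j k. \<lbrakk>i < 3; j < 3; k < 3\<rbrakk> \<Longrightarrow> y i \<noteq> w j k"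
      "\<And>i j. \<lbrakk>i < 3; j < 3\<rbrakk> \<Longrightarrow> x i = x j \<longleftrightarrow> i = j"
      "\<And>i j. \<lbrakk>i < 3; j < 3\<rbrakk> \<Longrightarrow> y i = y j \<longleftrightarrow> i = j"
      "\<And>i j k l. \<lbrakk>i < 3; j < 3; k < 3; l < 3\<rbrakk> \<Longrightarrow> w i j = w k l \<longleftrightarrow> i = k \<and> j = l"
  shows False
proof -
  have arc: "arc (c e)" and ends: "{pathstart (c e), pathfinish (c e)} = p ` e" if "e \<in> E" for e
    using D that by (auto simp: layered_drawing_def drawing_def)
  have nocross: "path_image (c e) \<inter> path_image (c f) \<subseteq> p ` (e \<inter> f)"
    if "e \<in> E" "f \<in> E" "e \<noteq> f" "layer e = layer f" for e f
    using D that by (auto simp: layered_drawing_def crossing_def)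
  \<comment> \<open>The curves of a drawing have no prescribed direction; \<gamma> is chosen to run
    from its first vertex to its second.\<close>
  have "\<exists>g. arc g \<and> pathstart g = p u \<and> pathfinish g = p v \<and> path_image g = path_image (c {u, v})"
    if e: "{u, v} \<in> E" for u v
  proof (cases "pathstart (c {u, v}) = p u")
    case True
    then have "pathfinish (c {u, v}) = p v"
      using ends[OF e] arc_distinct_ends[OF arc[OF e]] by (auto simp: doubleton_eq_iff)
    then show ?thesis using True arc[OF e] by blast
  next
    case False
    then have "pathstart (c {u, v}) = p v" "pathfinish (c {u, v}) = p u"
      using ends[OF e] by (auto simp: doubleton_eq_iff)
    then show ?thesis using arc[OF e]
      by (intro exI[of _ "reversepath (c {u, v})"]) (simp add: arc_reversepath)
  qed
  then obtain \<gamma> where \<gamma>: "\<And>u v. {u, v} \<in> E \<Longrightarrow> arc (\<gamma> u v)"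
    "\<And>u v. {u, v} \<in> E \<Longrightarrow> pathstart (\<gamma> u v) = p u" "\<And>u v. {u, v} \<in> E \<Longrightarrow> pathfinish (\<gamma> u v) = p v"
    "\<And>u v. {u, v} \<in> E \<Longrightarrow> path_image (\<gamma> u v) = path_image (c {u, v})"
    by metis
  define A B where "A i j = path_image (c {x i, w i j})" and "B i j = path_image (c {y j, w i j})" for i j
  note AB = A_def B_def
  have E: "{x i, w i j} \<in> E" "{w i j, y j} \<in> E" "{y j, w i j} \<in> E" if "i < 3" "j < 3" for i j
    using edges[OF that] by (auto simp: insert_commute)
  \<comment> \<open>Edges of one layer share at most the position of a common endpoint. The three
    inclusions list the possible endpoints: an \<open>x i\<close>, a \<open>y j\<close>, or the
    middle vertex of one path.\<close>
  have AA: "A i j \<inter> A k l \<subseteq> (if i = k then {p (x i)} else {})"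
    if "i < 3" "j < 3" "k < 3" "l < 3" "(i, j) \<noteq> (k, l)" for i j k l
  proof -
    have "A i j \<inter> A k l \<subseteq> p ` ({x i, w i j} \<inter> {x k, w k l})"
      unfolding AB using that E layers dist by (intro nocross) (auto simp: doubleton_eq_iff)
    then show ?thesis using that dist by (auto split: if_splits)
  qed
  have BB: "B i j \<inter> B k l \<subseteq> (if j = l then {p (y j)} else {})"
    if "i < 3" "j < 3" "k < 3" "l < 3" "(i, j) \<noteq> (k, l)" for i j k l
  proof -
    have "B i j \<inter> B k l \<subseteq> p ` ({y j, w i j} \<inter> {y l, w k l})"
      unfolding AB using that E layers dist by (intro nocross) (auto simp: doubleton_eq_iff)
    then show ?thesis using that dist by (auto split: if_splits)
  qed
  have AB': "A i j \<inter> B k l \<subseteq> (if (i, j) = (k, l) then {p (w i j)} else {})"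
    if "i < 3" "j < 3" "k < 3" "l < 3" for i j k l
  proof -
    have "A i j \<inter> B k l \<subseteq> p ` ({x i, w i j} \<inter> {y l, w k l})"
      unfolding AB using that E layers dist by (intro nocross) (auto simp: doubleton_eq_iff)
    then show ?thesis using that dist by (auto split: if_splits)
  qed
  define g where "g i j = \<gamma> (x i) (w i j) +++ \<gamma> (w i j) (y j)" for i j
  have im: "path_image (\<gamma> (x i) (w i j)) = A i j" "path_image (\<gamma> (w i j) (y j)) = B i j"
    if "i < 3" "j < 3" for i j
    using \<gamma>(4) E[OF that] by (auto simp: AB insert_commute)
  have g: "arc (g i j)" "pathstart (g i j) = p (x i)" "pathfinish (g i j) = p (y j)"
      "path_image (g i j) = A i j \<union> B i j" if "i < 3" "j < 3" for i j
  proof -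
    note [simp] = \<gamma>[OF E(1)[OF that]] \<gamma>(1-3)[OF E(2)[OF that]] im[OF that]
    show "arc (g i j)" unfolding g_def
      using AB'[OF that that] im(2)[OF that] im(1)[OF that] by (intro arc_join) auto
    show "pathstart (g i j) = p (x i)" "pathfinish (g i j) = p (y j)" by (simp_all add: g_def)
    show "path_image (g i j) = A i j \<union> B i j"
      unfolding g_def using im[OF that] by (subst path_image_join) auto
  qed
  have pA: "p (x i) \<in> A i j" "p (y j) \<in> B i j" if "i < 3" "j < 3" for i j
    using pathstart_in_path_image[of "\<gamma> (x i) (w i j)"] pathfinish_in_path_image[of "\<gamma> (w i j) (y j)"]
      \<gamma>(2)[OF E(1)[OF that]] \<gamma>(3)[OF E(2)[OF that]] im[OF that] by auto
  show False
  proof (rule K33_nonplanar[of g "\<lambda>i. p (x i)" "\<lambda>j. p (y j)"])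
    fix i j k l :: nat assume *: "i < 3" "j < 3" "k < 3" "l < 3" "i \<noteq> k" "j \<noteq> l"
    show "path_image (g i j) \<inter> path_image (g k l) = {}"
      using AA[of i j k l] BB[of i j k l] AB'[of i j k l] AB'[of k l i j] *
      by (auto simp: g(4))
  next
    fix i j l :: nat assume *: "i < 3" "j < 3" "l < 3" "j \<noteq> l"
    show "path_image (g i j) \<inter> path_image (g i l) = {p (x i)}"
      using AA[of i j i l] BB[of i j i l] AB'[of i j i l] AB'[of i l i j] pA(1)[of i j] pA(1)[of i l] *
      by (auto simp: g(4))
  next
    fix i j k :: nat assume *: "i < 3" "j < 3" "k < 3" "i \<noteq> k"
    show "path_image (g i j) \<inter> path_image (g k j) = {p (y j)}"
      using AA[of i j k j] BB[of i j k j] AB'[of i j k j] AB'[of k j i j] pA(2)[of i j] pA(2)[of k j] *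
      by (auto simp: g(4))
  qed (use g in auto)
qed

section \<open>Eppstein's graph and its thickness\<close>

datatype vertex = Base nat | Apex nat nat nat

instance vertex :: countable
  by countable_datatype

fun vertex_below :: "nat \<Rightarrow> vertex \<Rightarrow> bool" where
  "vertex_below n (Base i) \<longleftrightarrow> i < n"
| "vertex_below n (Apex i j k) \<longleftrightarrow> i < j \<and> j < k \<and> k < n"

definition foot :: "nat \<Rightarrow> nat \<Rightarrow> nat \<Rightarrow> nat \<Rightarrow> nat" where
  "foot r i j k = [i, j, k] ! r"

definition leg :: "nat \<Rightarrow> nat \<Rightarrow> nat \<Rightarrow> nat \<Rightarrow> nat set" where
  "leg r i j k = {to_nat (Base (foot r i j k)), to_nat (Apex i j k)}"

text \<open>Vertices are encoded as natural numbers because the final statement is about graphs on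
  \<open>nat\<close>.\<close>

definition tripod_V :: "nat \<Rightarrow> nat set" where
  "tripod_V n = to_nat ` {v. vertex_below n v}"

definition tripod_E :: "nat \<Rightarrow> nat set set" where
  "tripod_E n = {leg r i j k |r i j k. r < 3 \<and> i < j \<and> j < k \<and> k < n}"

lemma foot_simps [simp]: "foot 0 i j k = i" "foot (Suc 0) i j k = j" "foot 1 i j k = j" "foot 2 i j k = k"
  by (simp_all add: foot_def)

lemma less_3_cases: "r < 3 \<Longrightarrow> r = 0 \<or> r = 1 \<or> r = 2" for r :: nat
  by auto

lemma leg_eq_iff:
  assumes "r < 3" "i < j" "j < k" "r' < 3"
  shows "leg r i j k = leg r' i' j' k' \<longleftrightarrow> r = r' \<and> i = i' \<and> j = j' \<and> k = k'"
  using less_3_cases[OF \<open>r < 3\<close>] less_3_cases[OF \<open>r' < 3\<close>] assms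
  by (auto simp: leg_def doubleton_eq_iff)

lemma leg_in_tripod_E: "r < 3 \<Longrightarrow> i < j \<Longrightarrow> j < k \<Longrightarrow> k < n \<Longrightarrow> leg r i j k \<in> tripod_E n"
  unfolding tripod_E_def by blast

lemma simple_graph_tripod: "simple_graph (tripod_V n) (tripod_E n)"
  unfolding simple_graph_def
proof (intro conjI ballI)
  have "{v. vertex_below n v} \<subseteq> Base ` {..<n} \<union> (\<lambda>(i, j, k). Apex i j k) ` ({..<n} \<times> {..<n} \<times> {..<n})"
  proof
    fix v assume "v \<in> {v. vertex_below n v}"
    then show "v \<in> Base ` {..<n} \<union> (\<lambda>(i, j, k). Apex i j k) ` ({..<n} \<times> {..<n} \<times> {..<n})"
      by (cases v) (auto intro!: image_eqI[of _ _ "(_, _, _)"])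
  qed
  then show "finite (tripod_V n)"
    unfolding tripod_V_def by (intro finite_imageI) (erule finite_subset, simp)
  fix e assume "e \<in> tripod_E n"
  then obtain r i j k where e: "e = leg r i j k" "r < 3" "i < j" "j < k" "k < n"
    by (auto simp: tripod_E_def)
  then have "vertex_below n (Base (foot r i j k))" "vertex_below n (Apex i j k)"
    using less_3_cases[OF e(2)] by auto
  then show "e \<subseteq> tripod_V n" by (auto simp: e leg_def tripod_V_def)
  show "card e = 2" by (simp add: e leg_def)
qed

text \<open>Layer \<open>r\<close> consists of the legs to the \<open>r\<close>-th foot, so every
  apex is a leaf there. It is drawn with the base vertices at integers on the real axis and each
  apex at height one, slightly to the right of its foot in that layer.\<close>

lemma tripod_three_layers: "\<exists>p c layer. layered_drawing (tripod_V n) (tripod_E n) 3 p c layer"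
proof -
  define layer where "layer e = (THE r. r < 3 \<and> (\<exists>i j k. i < j \<and> j < k \<and> e = leg r i j k))" for e
  have layer: "layer (leg r i j k) = r" if "r < 3" "i < j" "j < k" for r i j k
    unfolding layer_def using that by (intro the_equality) (auto simp: leg_eq_iff)
  \<comment> \<open>Distinct offsets of at most one half: apexes above the same foot stay apart, and
    none reaches the next integer.\<close>
  define \<epsilon> where "\<epsilon> v = 1 / (2 + real (to_nat v))" for v :: vertex
  have \<epsilon>: "0 < \<epsilon> v" "\<epsilon> v \<le> 1 / 2" "\<epsilon> v = \<epsilon> v' \<longleftrightarrow> v = v'" for v v'
    by (auto simp: \<epsilon>_def field_simps)
  define pos where "pos l v = (case v of Base i \<Rightarrow> Complex (real i) 0
      | Apex i j k \<Rightarrow> Complex (real (foot l i j k) + \<epsilon> v) 1)" for l v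
  define P where "P l u = pos l (from_nat u)" for l u
  have P: "P l (to_nat (Base i)) = Complex (real i) 0"
    "P l (to_nat (Apex i j k)) = Complex (real (foot l i j k) + \<epsilon> (Apex i j k)) 1" for l i j k
    by (simp_all add: P_def pos_def)
  \<comment> \<open>At height \<open>s\<close> the leg from foot \<open>a\<close> to apex
    \<open>v\<close> has abscissa \<open>a + \<epsilon> v * s\<close>, so distinct legs of one layer
    can meet only at a common foot.\<close>
  have col: "real a + \<epsilon> v * s = real a' + \<epsilon> v' * s \<longleftrightarrow> a = a' \<and> (s = 0 \<or> v = v')"
    if "0 \<le> s" "s \<le> 1" for a a' v v' s
  proof -
    have "0 \<le> \<epsilon> v * s" "\<epsilon> v * s \<le> 1 / 2" for v
    proof -
      show "0 \<le> \<epsilon> v * s" using \<epsilon>(1)[of v] that by simp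
      have "\<epsilon> v * s \<le> \<epsilon> v" using \<epsilon>(1)[of v] that by (intro mult_left_le) auto
      then show "\<epsilon> v * s \<le> 1 / 2" using \<epsilon>(2)[of v] by linarith
    qed
    note this[of v] this[of v']
    then have "a = a'" if "real a + \<epsilon> v * s = real a' + \<epsilon> v' * s"
      using that by linarith
    then show ?thesis using \<epsilon>(3)[of v v'] by auto
  qed
  have inj: "inj_on (P l) (tripod_V n)" for l
  proof -
    have "v = v'" if "pos l v = pos l v'" for v v'
      using that col[of 1 _ v _ v'] by (cases v; cases v') (auto simp: pos_def)
    then show ?thesis by (auto simp: inj_on_def tripod_V_def P_def)
  qed
  define S where "S r i j k = closed_segment (P r (to_nat (Base (foot r i j k)))) (P r (to_nat (Apex i j k)))" for r i j k
  have S: "z \<in> S r i j k \<longleftrightarrow> (\<exists>s. 0 \<le> s \<and> s \<le> 1 \<and> z = Complex (real (foot r i j k) + \<epsilon> (Apex i j k) * s) s)"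
    for z r i j k
    unfolding S_def P closed_segment_def by (auto simp: complex_eq_iff algebra_simps)
  have seg: "closed_segment (P r u) (P r v) = S r i j k" if "{u, v} = leg r i j k" for r i j k u v
    using that by (auto simp: S_def leg_def doubleton_eq_iff closed_segment_commute)
  have "\<exists>p c. layered_drawing (tripod_V n) (tripod_E n) 3 p c layer"
  proof (rule layered_drawing_if_straight_layers[OF simple_graph_tripod _ inj])
    show "layer e < 3" if "e \<in> tripod_E n" for e
      using that by (auto simp: tripod_E_def layer)
  next
    fix u v assume "{u, v} \<in> tripod_E n"
    then obtain r i j k where e: "{u, v} = leg r i j k" "r < 3" "i < j" "j < k" "k < n"
      by (auto simp: tripod_E_def)
    have "a \<in> leg r i j k" if "P r a \<in> S r i j k" "a \<in> tripod_V n" for a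
    proof -
      obtain w :: vertex where w: "a = to_nat w" using \<open>a \<in> tripod_V n\<close> by (auto simp: tripod_V_def)
      obtain s where s: "0 \<le> s" "s \<le> 1" "P r a = Complex (real (foot r i j k) + \<epsilon> (Apex i j k) * s) s"
        using S \<open>P r a \<in> S r i j k\<close> by blast
      show ?thesis
      proof (cases w)
        case (Base i')
        then show ?thesis using s by (auto simp: w P leg_def)
      next
        case (Apex i' j' k')
        then show ?thesis using s col[of 1 "foot r i' j' k'" w "foot r i j k" "Apex i j k"]
          by (auto simp: w P leg_def)
      qed
    qed
    then show "closed_segment (P (layer {u, v}) u) (P (layer {u, v}) v) \<inter> P (layer {u, v}) ` tripod_V n
       \<subseteq> P (layer {u, v}) ` {u, v}"
      using e by (auto simp: layer seg)
  next
    fix u v u' v' assume uv: "{u, v} \<in> tripod_E n" "{u', v'} \<in> tripod_E n" "{u, v} \<noteq> {u', v'}"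
      "layer {u', v'} = layer {u, v}"
    from uv(1) obtain r i j k where e: "{u, v} = leg r i j k" "r < 3" "i < j" "j < k" "k < n"
      by (auto simp: tripod_E_def)
    from uv(2) obtain r' i' j' k' where e': "{u', v'} = leg r' i' j' k'" "r' < 3" "i' < j'" "j' < k'" "k' < n"
      by (auto simp: tripod_E_def)
    have r: "r' = r" using uv(4) e e' by (simp add: layer)
    have "z \<in> P r ` (leg r i j k \<inter> leg r i' j' k')" if z: "z \<in> S r i j k" "z \<in> S r i' j' k'" for z
    proof -
      obtain s where s: "0 \<le> s" "s \<le> 1" "z = Complex (real (foot r i j k) + \<epsilon> (Apex i j k) * s) s"
          "z = Complex (real (foot r i' j' k') + \<epsilon> (Apex i' j' k') * s) s"
        using z unfolding S by auto
      then have "foot r i j k = foot r i' j' k' \<and> (s = 0 \<or> Apex i j k = Apex i' j' k')"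
        using col[OF s(1,2)] by (metis complex.inject)
      moreover have "Apex i j k \<noteq> Apex i' j' k'" using uv(3) e e' r by auto
      ultimately have "foot r i j k = foot r i' j' k'" "z = P r (to_nat (Base (foot r i j k)))"
        using s(3) by (auto simp: P)
      then show ?thesis by (auto simp: leg_def)
    qed
    then show "closed_segment (P (layer {u, v}) u) (P (layer {u, v}) v) \<inter> closed_segment (P (layer {u, v}) u') (P (layer {u, v}) v')
       \<subseteq> P (layer {u, v}) ` ({u, v} \<inter> {u', v'})"
      using e e' r by (auto simp: layer seg)
  qed
  then show ?thesis by blast
qed

text \<open>Triples are coloured by the layers of their three legs. On seven base vertices from
  Ramsey's theorem the layer of a leg depends only on \<open>r\<close>, and with two layers two of
  the three values of \<open>r\<close> share one.\<close>

lemma tripod_two_layers_impossible: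
  "\<exists>N. \<forall>n\<ge>N. \<forall>k\<le>2. \<forall>p c layer. \<not> layered_drawing (tripod_V n) (tripod_E n) k p c layer"
proof -
  define C :: "(nat \<times> nat \<times> nat) set" where "C = {..<2} \<times> {..<2} \<times> {..<2}"
  have "finite C" by (simp add: C_def)
  from Ramsey_order_invariant[OF this, of 7 3] obtain N where
    N: "\<And>col. (\<forall>xs. col xs \<in> C) \<Longrightarrow> \<exists>H\<subseteq>{..<N}. card H = 7 \<and>
       (\<forall>xs ys. set xs \<subseteq> H \<longrightarrow> set ys \<subseteq> H \<longrightarrow> length xs = 3 \<longrightarrow> ranks xs = ranks ys \<longrightarrow> col xs = col ys)"
    by blast
  show ?thesis
  proof (intro exI[of _ N] allI impI notI)
    fix n m p c layer assume "N \<le> n" "m \<le> 2" and D: "layered_drawing (tripod_V n) (tripod_E n) m p c layer"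
    \<comment> \<open>The \<open>mod 2\<close> keeps colours in \<open>C\<close> for arbitrary
      lists; layers of actual edges are below 2 and unaffected.\<close>
    define col where "col xs = (let f = (\<lambda>r. layer (leg r (xs ! 0) (xs ! 1) (xs ! 2)) mod 2) in (f 0, f 1, f 2))" for xs
    have "\<forall>xs. col xs \<in> C" by (simp add: col_def C_def Let_def)
    from N[OF this] obtain H where H: "H \<subseteq> {..<N}" "card H = 7" and
      hom: "\<And>xs ys. set xs \<subseteq> H \<Longrightarrow> set ys \<subseteq> H \<Longrightarrow> length xs = 3 \<Longrightarrow> ranks xs = ranks ys \<Longrightarrow> col xs = col ys"
      by blast
    define h where "h i = sorted_list_of_set H ! i" for i
    have fin: "finite H" using H finite_subset by blast
    have h: "h i < h j" if "i < j" "j < 7" for i j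
      using sorted_wrt_nth_less[OF strict_sorted_list_of_set, of i j H] that H by (simp add: h_def)
    have hH: "h i \<in> H" if "i < 7" for i
      using nth_mem[of i "sorted_list_of_set H"] that H fin by (simp add: h_def)
    then have hn: "h i < n" if "i < 7" for i using H \<open>N \<le> n\<close> that by force
    define f where "f r = layer (leg r (h 0) (h 1) (h 2))" for r
    have lt: "leg r (h i) (h j) (h k) \<in> tripod_E n" "layer (leg r (h i) (h j) (h k)) < 2"
      if "r < 3" "i < j" "j < k" "k < 7" for r i j k
    proof -
      show *: "leg r (h i) (h j) (h k) \<in> tripod_E n"
        using that h hn by (intro leg_in_tripod_E) auto
      show "layer (leg r (h i) (h j) (h k)) < 2"
        using D * \<open>m \<le> 2\<close> unfolding layered_drawing_def by fastforce
    qed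
    have f: "layer (leg r (h i) (h j) (h k)) = f r" if "r < 3" "i < j" "j < k" "k < 7" for r i j k
    proof -
      have "ranks [h i, h j, h k] = ranks [h 0, h 1, h 2]"
        using h[of i j] h[of j k] h[of i k] h[of 0 1] h[of 1 2] h[of 0 2] that by (simp add: ranks_def)
      then have "col [h i, h j, h k] = col [h 0, h 1, h 2]"
        using that hH by (intro hom) auto
      then show ?thesis using that less_3_cases[OF \<open>r < 3\<close>] lt(2)[of r i j k] lt(2)[of r 0 1 2] 
        by (auto simp: col_def Let_def f_def)
    qed
    have h_eq: "h i = h j \<longleftrightarrow> i = j" if "i < 7" "j < 7" for i j
      using h[of i j] h[of j i] that by (cases i j rule: linorder_cases) auto
    \<comment> \<open>The nine triples given by \<open>I\<close>, \<open>J\<close>, \<open>K\<close>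
      supply the subdividing apexes: their feet number \<open>r\<close> and \<open>r'\<close> are
      \<open>X i\<close> and \<open>Y j\<close>.\<close>
    have K33: False if r: "r < 3" "r' < 3" "f r = f r'"
      and T: "\<And>i j. i < 3 \<Longrightarrow> j < 3 \<Longrightarrow> I i j < J i j \<and> J i j < K i j \<and> K i j < 7 \<and>
         foot r (I i j) (J i j) (K i j) = X i \<and> foot r' (I i j) (J i j) (K i j) = Y j"
      and XY: "\<And>i j. i < 3 \<Longrightarrow> j < 3 \<Longrightarrow> X i < 7 \<and> Y j < 7 \<and> X i \<noteq> Y j"
        "\<And>i j. i < 3 \<Longrightarrow> j < 3 \<Longrightarrow> X i = X j \<longleftrightarrow> i = j" "\<And>i j. i < 3 \<Longrightarrow> j < 3 \<Longrightarrow> Y i = Y j \<longleftrightarrow> i = j"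
      for r r' :: nat and I J K :: "nat \<Rightarrow> nat \<Rightarrow> nat" and X Y :: "nat \<Rightarrow> nat"
    proof -
      define x y where "x i = to_nat (Base (h (X i)))" and "y j = to_nat (Base (h (Y j)))" for i j
      define w where "w i j = to_nat (Apex (h (I i j)) (h (J i j)) (h (K i j)))" for i j
      show False
      proof (rule layer_no_subdivided_K33[OF D, of x w y "f r"])
        fix i j :: nat assume ij: "i < 3" "j < 3"
        have h_foot: "foot r (h a) (h b) (h c) = h (foot r a b c)" if "r < 3" for r a b c
          using less_3_cases[OF that] by auto
        have legs: "{x i, w i j} = leg r (h (I i j)) (h (J i j)) (h (K i j))"
           "{y j, w i j} = leg r' (h (I i j)) (h (J i j)) (h (K i j))"
          using T[OF ij] r h_foot by (auto simp: leg_def x_def y_def w_def)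
        show "{x i, w i j} \<in> tripod_E n \<and> {y j, w i j} \<in> tripod_E n"
          unfolding legs using lt(1) r T[OF ij] by simp
        show "layer {x i, w i j} = f r \<and> layer {y j, w i j} = f r"
          unfolding legs using f r T[OF ij] by simp
        show "x i \<noteq> y j" "x i = x j \<longleftrightarrow> i = j" "y i = y j \<longleftrightarrow> i = j"
          using XY ij by (auto simp: x_def y_def h_eq)
        fix k :: nat assume "k < 3"
        show "x i \<noteq> w j k" "y i \<noteq> w j k" by (auto simp: x_def y_def w_def)
        fix l :: nat assume "l < 3"
        show "w i j = w k l \<longleftrightarrow> i = k \<and> j = l"
        proof
          assume "w i j = w k l"
          then have "I i j = I k l" "J i j = J k l" "K i j = K k l"
            using T[OF ij] T[OF \<open>k < 3\<close> \<open>l < 3\<close>] by (auto simp: w_def h_eq)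
          then have "X i = X k" "Y j = Y l"
            using T[OF ij] T[OF \<open>k < 3\<close> \<open>l < 3\<close>] by auto
          then show "i = k \<and> j = l" using XY(2,3) ij \<open>k < 3\<close> \<open>l < 3\<close> by auto
        qed auto
      qed
    qed
    have "f r < 2" if "r < 3" for r
      using lt(2)[OF that, of 0 1 2] by (simp add: f_def)
    from this[of 0] this[of 1] this[of 2] consider "f 0 = f 1" | "f 0 = f 2" | "f 1 = f 2"
      by force
    then show False
    \<comment> \<open>Each side of the bipartite graph takes three indices, and one further index is
      the remaining foot of all nine triples: the largest, middle or smallest one. This makes
      seven.\<close>
    proof cases
      case 1
      then show False
        by (intro K33[of 0 1 "\<lambda>i j. i" "\<lambda>i j. 3 + j" "\<lambda>i j. 6" "\<lambda>i. i" "\<lambda>j. 3 + j"]) auto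
    next
      case 2
      then show False
        by (intro K33[of 0 2 "\<lambda>i j. i" "\<lambda>i j. 3" "\<lambda>i j. 4 + j" "\<lambda>i. i" "\<lambda>j. 4 + j"]) auto
    next
      case 3
      then show False
        by (intro K33[of 1 2 "\<lambda>i j. 0" "\<lambda>i j. 1 + i" "\<lambda>i j. 4 + j" "\<lambda>i. 1 + i" "\<lambda>j. 4 + j"]) auto
    qed
  qed
qed

section \<open>Straight-line drawings of the tripod graph\<close>

text \<open>Here \<open>C\<close> abstracts positivity of \<open>orient\<close>. The assumption
  \<open>GP\<close> says that the three signed terms of a Grassmann-Pluecker relation are neither
  all positive nor all negative, \<open>base\<close> expresses convex position, and
  \<open>nocross\<close> forbids that two legs of the same kind each separate the ends of the
  other.\<close>

lemma no_order_invariant_tripods: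
  fixes C :: "vertex \<Rightarrow> vertex \<Rightarrow> vertex \<Rightarrow> bool"
  assumes rotate: "\<And>a b c. C a b c = C b c a"
    and swap: "\<And>a b c. \<lbrakk>vertex_below 7 a; vertex_below 7 b; vertex_below 7 c; distinct [a, b, c]\<rbrakk> \<Longrightarrow>
       C a c b = (\<not> C a b c)"
    and GP: "\<And>a b c d e. \<lbrakk>vertex_below 7 a; vertex_below 7 b; vertex_below 7 c; vertex_below 7 d;
       vertex_below 7 e; distinct [a, b, c, d, e]\<rbrakk> \<Longrightarrow>
       \<not> (C a b c = C a d e \<and> C a b d \<noteq> C a c e \<and> C a b e = C a c d) \<and>
       (C a b c = C a d e \<or> C a b d \<noteq> C a c e \<or> C a b e = C a c d)"
    and base: "\<And>i j k. \<lbrakk>i < j; j < k; k < 7\<rbrakk> \<Longrightarrow> C (Base i) (Base j) (Base k)"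
    and inv1: "\<And>i j k x y i' j' k' x' y'.
       \<lbrakk>i < j; j < k; k < 7; x < y; y < 7; i' < j'; j' < k'; k' < 7; x' < y'; y' < 7;
        ranks [i, j, k, x, y] = ranks [i', j', k', x', y']\<rbrakk> \<Longrightarrow>
       C (Apex i j k) (Base x) (Base y) = C (Apex i' j' k') (Base x') (Base y')"
    and inv2: "\<And>i j k l m n x i' j' k' l' m' n' x'.
       \<lbrakk>i < j; j < k; k < 7; l < m; m < n; n < 7; x < 7; i < l;
        i' < j'; j' < k'; k' < 7; l' < m'; m' < n'; n' < 7; x' < 7; i' < l';
        ranks [i, j, k, l, m, n, x] = ranks [i', j', k', l', m', n', x']\<rbrakk> \<Longrightarrow>
       C (Apex i j k) (Apex l m n) (Base x) = C (Apex i' j' k') (Apex l' m' n') (Base x')"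
    and nocross: "\<And>r i j k l m n.
       \<lbrakk>r < 3; i < j; j < k; k < 7; l < m; m < n; n < 7; foot r i j k \<noteq> foot r l m n\<rbrakk> \<Longrightarrow>
       C (Base (foot r i j k)) (Apex i j k) (Base (foot r l m n)) =
         C (Base (foot r i j k)) (Apex i j k) (Apex l m n) \<or>
       C (Base (foot r l m n)) (Apex l m n) (Base (foot r i j k)) =
         C (Base (foot r l m n)) (Apex l m n) (Apex i j k)"
  shows False
proof -
  \<comment> \<open>By order invariance the truth value of \<open>C\<close> is a function of the
    ranks. Hence all instances with the same pattern become the same propositional atom.\<close>
  define R1 where "R1 xs \<longleftrightarrow> (\<exists>i j k x y. i < j \<and> j < k \<and> k < 7 \<and> x < y \<and> y < 7 \<and>
     xs = ranks [i, j, k, x, y] \<and> C (Apex i j k) (Base x) (Base y))" for xs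
  define R2 where "R2 xs \<longleftrightarrow> (\<exists>i j k l m n x. i < j \<and> j < k \<and> k < 7 \<and> l < m \<and> m < n \<and> n < 7 \<and> x < 7 \<and> i < l \<and>
     xs = ranks [i, j, k, l, m, n, x] \<and> C (Apex i j k) (Apex l m n) (Base x))" for xs
  have r1: "C (Apex i j k) (Base x) (Base y) = R1 (ranks [i, j, k, x, y])"
    if "i < j" "j < k" "k < 7" "x < y" "y < 7" for i j k x y
    unfolding R1_def
  proof
    assume "C (Apex i j k) (Base x) (Base y)"
    then show "\<exists>i' j' k' x' y'. i' < j' \<and> j' < k' \<and> k' < 7 \<and> x' < y' \<and> y' < 7 \<and>
      ranks [i, j, k, x, y] = ranks [i', j', k', x', y'] \<and> C (Apex i' j' k') (Base x') (Base y')"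
      using that by blast
  qed (use inv1[OF that] in metis)
  have r2: "C (Apex i j k) (Apex l m n) (Base x) = R2 (ranks [i, j, k, l, m, n, x])"
    if "i < j" "j < k" "k < 7" "l < m" "m < n" "n < 7" "x < 7" "i < l" for i j k l m n x
    unfolding R2_def
  proof
    assume "C (Apex i j k) (Apex l m n) (Base x)"
    then show "\<exists>i' j' k' l' m' n' x'. i' < j' \<and> j' < k' \<and> k' < 7 \<and> l' < m' \<and> m' < n' \<and> n' < 7 \<and> x' < 7 \<and> i' < l' \<and>
      ranks [i, j, k, l, m, n, x] = ranks [i', j', k', l', m', n', x'] \<and> C (Apex i' j' k') (Apex l' m' n') (Base x')"
      using that by blast
  qed (use inv2[OF that] in metis)
  \<comment> \<open>These equations bring atoms into normal form: apexes first, ordered by smallest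
    foot, then base vertices in increasing order.\<close>
  have s1: "C (Base x) (Apex i j k) (Apex l m n) = C (Apex i j k) (Apex l m n) (Base x)"
    "C (Apex i j k) (Base x) (Apex l m n) = C (Apex l m n) (Apex i j k) (Base x)"
    "C (Base x) (Base y) (Apex i j k) = C (Apex i j k) (Base x) (Base y)"
    "C (Base x) (Apex i j k) (Base y) = C (Apex i j k) (Base y) (Base x)" for i j k l m n x y
    using rotate by metis+
  have s2: "C (Apex i j k) (Base y) (Base x) = (\<not> C (Apex i j k) (Base x) (Base y))"
    if "i < j" "j < k" "k < 7" "x < y" "y < 7" for i j k x y
    using that by (intro swap) auto
  have s3: "C (Apex l m n) (Apex i j k) (Base x) = (\<not> C (Apex i j k) (Apex l m n) (Base x))"
    if "i < j" "j < k" "k < 7" "l < m" "m < n" "n < 7" "x < 7" "i < l" for i j k l m n x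
    using that swap[of "Base x" "Apex i j k" "Apex l m n"] by (simp add: s1)
  have b: "C (Base i) (Base j) (Base k)" "C (Base j) (Base k) (Base i)" "C (Base k) (Base i) (Base j)"
    "\<not> C (Base i) (Base k) (Base j)" "\<not> C (Base k) (Base j) (Base i)" "\<not> C (Base j) (Base i) (Base k)"
    if "i < j" "j < k" "k < 7" for i j k
  proof -
    show *: "C (Base i) (Base j) (Base k)" using base[OF that] .
    then show **: "C (Base j) (Base k) (Base i)" "C (Base k) (Base i) (Base j)"
      using rotate by metis+
    show "\<not> C (Base i) (Base k) (Base j)" "\<not> C (Base k) (Base j) (Base i)" "\<not> C (Base j) (Base i) (Base k)"
      using * ** swap[of "Base i" "Base j" "Base k"] swap[of "Base k" "Base i" "Base j"]
        swap[of "Base j" "Base k" "Base i"] that by auto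
  qed
  \<comment> \<open>The remaining problem is propositional in the values of \<open>R1\<close> and \<open>R2\<close>. The instances below are a
    minimal unsatisfiable set of constraints, found with a SAT solver; they only involve the pairs of
    disjoint triples that are ordered like 024/135, 025/134, 034/125 or 035/124.\<close>
  note leg0 = nocross[of 0, unfolded foot_simps] and leg1 = nocross[of 1, unfolded foot_simps]
    and leg2 = nocross[of 2, unfolded foot_simps]
  note constraints =
    GP[of "Apex 0 2 4" "Apex 1 3 5" "Base 0" "Base 1" "Base 3"]
    GP[of "Apex 0 2 5" "Apex 1 3 4" "Base 0" "Base 1" "Base 3"]
    GP[of "Apex 0 2 5" "Apex 1 3 6" "Base 1" "Base 3" "Base 4"]
    GP[of "Apex 0 2 6" "Apex 1 3 5" "Base 0" "Base 2" "Base 4"]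
    GP[of "Apex 0 2 6" "Apex 1 3 5" "Base 0" "Base 4" "Base 5"]
    GP[of "Apex 0 2 6" "Apex 1 3 5" "Base 1" "Base 3" "Base 4"]
    GP[of "Apex 0 3 4" "Apex 1 2 5" "Base 0" "Base 1" "Base 5"]
    GP[of "Apex 0 3 4" "Apex 1 2 5" "Base 0" "Base 2" "Base 3"]
    GP[of "Apex 0 3 4" "Apex 1 2 5" "Base 2" "Base 4" "Base 5"]
    GP[of "Apex 0 3 4" "Apex 1 2 5" "Base 3" "Base 4" "Base 5"]
    GP[of "Apex 0 3 4" "Apex 1 2 6" "Base 0" "Base 2" "Base 5"]
    GP[of "Apex 0 3 5" "Apex 1 2 4" "Base 1" "Base 3" "Base 4"]
    GP[of "Apex 1 2 4" "Apex 0 3 6" "Base 0" "Base 1" "Base 5"]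
    GP[of "Apex 1 2 4" "Apex 0 3 6" "Base 1" "Base 2" "Base 5"]
    GP[of "Apex 1 2 5" "Apex 0 3 4" "Base 1" "Base 4" "Base 5"]
    GP[of "Apex 1 2 6" "Apex 0 3 4" "Base 0" "Base 3" "Base 5"]
    GP[of "Apex 1 2 6" "Apex 0 3 4" "Base 1" "Base 2" "Base 5"]
    GP[of "Apex 1 2 6" "Apex 0 3 4" "Base 3" "Base 4" "Base 5"]
    GP[of "Apex 1 3 5" "Apex 0 2 6" "Base 0" "Base 4" "Base 6"]
    GP[of "Apex 1 3 5" "Apex 2 4 6" "Base 0" "Base 1" "Base 2"]
    GP[of "Apex 1 3 5" "Apex 2 4 6" "Base 0" "Base 2" "Base 6"]
    GP[of "Apex 1 3 6" "Apex 0 2 4" "Base 0" "Base 1" "Base 5"]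
    GP[of "Apex 1 3 6" "Apex 0 2 4" "Base 1" "Base 2" "Base 5"]
    GP[of "Apex 1 3 6" "Apex 0 2 4" "Base 2" "Base 3" "Base 5"]
    GP[of "Apex 1 3 6" "Apex 0 2 5" "Base 0" "Base 4" "Base 5"]
    GP[of "Apex 1 3 6" "Apex 0 2 5" "Base 1" "Base 2" "Base 4"]
    GP[of "Base 0" "Apex 0 2 3" "Base 1" "Base 3" "Base 4"]
    GP[of "Base 0" "Apex 0 2 4" "Base 1" "Base 2" "Base 3"]
    GP[of "Base 0" "Apex 0 2 5" "Apex 1 4 6" "Base 1" "Base 3"]
    GP[of "Base 0" "Apex 0 2 6" "Apex 1 3 5" "Base 1" "Base 4"]
    GP[of "Base 0" "Apex 0 2 6" "Apex 1 4 5" "Base 3" "Base 5"]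
    GP[of "Base 0" "Apex 1 2 4" "Base 1" "Base 3" "Base 4"]
    GP[of "Base 0" "Apex 1 2 4" "Base 1" "Base 3" "Base 5"]
    GP[of "Base 1" "Apex 0 1 3" "Base 2" "Base 3" "Base 4"]
    GP[of "Base 1" "Apex 0 2 3" "Base 0" "Base 3" "Base 4"]
    GP[of "Base 1" "Apex 0 2 4" "Apex 1 3 5" "Base 0" "Base 2"]
    GP[of "Base 1" "Apex 0 2 4" "Apex 1 3 6" "Base 3" "Base 5"]
    GP[of "Base 1" "Apex 0 2 4" "Base 0" "Base 3" "Base 4"]
    GP[of "Base 1" "Apex 0 2 6" "Apex 1 3 4" "Base 0" "Base 5"]
    GP[of "Base 1" "Apex 0 3 4" "Apex 1 2 5" "Base 4" "Base 6"]
    GP[of "Base 1" "Apex 0 3 4" "Apex 1 2 6" "Base 3" "Base 5"]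
    GP[of "Base 1" "Apex 0 3 5" "Apex 1 2 4" "Base 0" "Base 3"]
    GP[of "Base 1" "Apex 0 3 5" "Apex 1 2 6" "Base 0" "Base 4"]
    GP[of "Base 1" "Apex 1 3 5" "Base 0" "Base 2" "Base 4"]
    GP[of "Base 2" "Apex 0 1 3" "Base 1" "Base 3" "Base 4"]
    GP[of "Base 2" "Apex 0 2 4" "Apex 1 3 5" "Base 1" "Base 6"]
    GP[of "Base 2" "Apex 0 2 4" "Apex 1 3 5" "Base 3" "Base 6"]
    GP[of "Base 2" "Apex 0 2 5" "Apex 1 3 6" "Base 1" "Base 4"]
    GP[of "Base 2" "Apex 0 2 6" "Apex 1 3 4" "Base 1" "Base 5"]
    GP[of "Base 2" "Apex 1 3 4" "Base 0" "Base 1" "Base 5"]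
    GP[of "Base 3" "Apex 0 2 4" "Base 0" "Base 1" "Base 4"]
    GP[of "Base 3" "Apex 0 2 6" "Apex 1 3 4" "Base 2" "Base 5"]
    GP[of "Base 3" "Apex 0 3 4" "Apex 1 2 5" "Base 1" "Base 2"]
    GP[of "Base 3" "Apex 0 3 5" "Apex 1 2 6" "Base 0" "Base 4"]
    GP[of "Base 3" "Apex 1 2 4" "Base 0" "Base 1" "Base 5"]
    GP[of "Base 3" "Apex 1 2 5" "Base 0" "Base 4" "Base 5"]
    GP[of "Base 4" "Apex 0 1 3" "Base 0" "Base 2" "Base 3"]
    GP[of "Base 4" "Apex 0 2 5" "Apex 1 3 6" "Base 0" "Base 1"]
    GP[of "Base 4" "Apex 0 2 6" "Apex 1 3 5" "Base 0" "Base 3"]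
    GP[of "Base 4" "Apex 0 3 5" "Apex 1 2 4" "Base 3" "Base 5"]
    GP[of "Base 4" "Apex 0 4 6" "Apex 1 3 5" "Base 1" "Base 2"]
    GP[of "Base 5" "Apex 0 2 4" "Apex 1 3 6" "Base 0" "Base 1"]
    GP[of "Base 5" "Apex 0 2 4" "Base 0" "Base 1" "Base 3"]
    GP[of "Base 5" "Apex 0 2 4" "Base 1" "Base 2" "Base 3"]
    GP[of "Base 5" "Apex 0 2 5" "Apex 1 4 6" "Base 1" "Base 3"]
    GP[of "Base 5" "Apex 0 2 5" "Apex 1 4 6" "Base 3" "Base 6"]
    GP[of "Base 5" "Apex 0 3 4" "Apex 1 2 6" "Base 0" "Base 2"]
    GP[of "Base 5" "Apex 0 3 4" "Apex 1 2 6" "Base 1" "Base 2"]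
    GP[of "Base 5" "Apex 0 3 5" "Apex 1 2 6" "Base 0" "Base 4"]
    GP[of "Base 5" "Apex 0 3 6" "Apex 1 2 4" "Base 1" "Base 4"]
    GP[of "Base 5" "Apex 0 4 6" "Apex 1 3 5" "Base 2" "Base 4"]
    GP[of "Base 5" "Apex 0 4 6" "Apex 1 3 5" "Base 2" "Base 6"]
    GP[of "Base 5" "Apex 1 3 4" "Base 0" "Base 2" "Base 4"]
    GP[of "Base 6" "Apex 0 2 5" "Apex 1 3 6" "Base 1" "Base 4"]
    GP[of "Base 6" "Apex 0 2 5" "Apex 1 4 6" "Base 1" "Base 3"]
    GP[of "Base 6" "Apex 0 4 5" "Apex 1 2 6" "Base 0" "Base 3"]
    GP[of "Base 6" "Apex 0 4 5" "Apex 1 2 6" "Base 3" "Base 5"] leg0[of 0 2 4 1 3 5]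
    leg0[of 0 2 5 1 3 4] leg0[of 0 3 4 1 2 5] leg0[of 0 3 5 1 2 4] leg1[of 0 2 4 1 3 5]
    leg1[of 0 2 5 1 3 4] leg1[of 0 3 4 1 2 5] leg1[of 0 3 5 1 2 4] leg2[of 0 2 4 1 3 5]
    leg2[of 0 2 5 1 3 4] leg2[of 0 3 4 1 2 5]
  \<comment> \<open>Atoms are normalised and expressed by \<open>R1\<close> and \<open>R2\<close>,
    then the ranks are evaluated to numerals, which identifies equal patterns.\<close>
  note clauses = constraints[simplified s1 s2 s3 b r1 r2, simplified ranks_def, simplified]
  show False using clauses by sat
qed

text \<open>Embeds the instance with seven base vertices into the large graph along an increasing
  \<open>h\<close>.\<close>

fun relabel :: "(nat \<Rightarrow> nat) \<Rightarrow> vertex \<Rightarrow> vertex" where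
  "relabel h (Base i) = Base (h i)"
| "relabel h (Apex i j k) = Apex (h i) (h j) (h k)"

text \<open>After perturbation all orientations are nonzero. Ramsey's theorem for their signs and
  for the layers then yields an assignment \<open>C\<close> as excluded by
  \<open>no_order_invariant_tripods\<close>.\<close>

lemma tripod_straight_impossible:
  assumes "t > 0"
  shows "\<exists>N. \<forall>n\<ge>N. \<forall>m\<le>t. \<forall>p c layer.
    \<not> (layered_drawing (tripod_V n) (tripod_E n) m p c layer \<and> straight_line (tripod_E n) p c)"
proof -
  define C :: "(bool \<times> bool \<times> bool \<times> nat \<times> nat \<times> nat) set" 
    where "C = UNIV \<times> UNIV \<times> UNIV \<times> {..<t} \<times> {..<t} \<times> {..<t}"
  have "finite C" by (simp add: C_def)
  from Ramsey_order_invariant[OF this, of 7 7] obtain N where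
    N: "\<And>col. (\<forall>xs. col xs \<in> C) \<Longrightarrow> \<exists>H\<subseteq>{..<N}. card H = 7 \<and>
       (\<forall>xs ys. set xs \<subseteq> H \<longrightarrow> set ys \<subseteq> H \<longrightarrow> length xs = 7 \<longrightarrow> ranks xs = ranks ys \<longrightarrow> col xs = col ys)"
    by blast
  show ?thesis
  proof (intro exI[of _ N] allI impI notI, elim conjE)
    fix n m p c layer assume "N \<le> n" "m \<le> t" and D: "layered_drawing (tripod_V n) (tripod_E n) m p c layer"
      and straight: "straight_line (tripod_E n) p c"
    let ?V = "tripod_V n" and ?E = "tripod_E n"
    have fin: "finite ?V" "finite ?E"
      using simple_graph_tripod[of n] finite_subset[of ?E "Pow ?V"] by (auto simp: simple_graph_def)
    have layer_lt: "layer e < t" if "e \<in> ?E" for e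
      using D that \<open>m \<le> t\<close> unfolding layered_drawing_def by fastforce
    \<comment> \<open>Only finitely many pairs of segments have to stay disjoint, so one \<epsilon>
      suits all of them.\<close>
    define F where "F = {(u, v, u', v'). u \<in> ?V \<and> v \<in> ?V \<and> u' \<in> ?V \<and> v' \<in> ?V \<and>
      closed_segment (p u) (p v) \<inter> closed_segment (p u') (p v') = {}}"
    have "finite F"
      using fin by (auto simp: F_def intro: finite_subset[of _ "?V \<times> ?V \<times> ?V \<times> ?V"])
    define stable where "stable \<epsilon> = (\<lambda>(u, v, u', v'). \<forall>a b c d. dist (p u) a < \<epsilon> \<longrightarrow> dist (p v) b < \<epsilon> \<longrightarrow>
        dist (p u') c < \<epsilon> \<longrightarrow> dist (p v') d < \<epsilon> \<longrightarrow> closed_segment a b \<inter> closed_segment c d = {})" for \<epsilon>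
    have "\<forall>\<^sub>F \<epsilon> in at_right 0. stable \<epsilon> x" if "x \<in> F" for x
    proof -
      obtain u v u' v' where x: "x = (u, v, u', v')" by (cases x)
      then have "closed_segment (p u) (p v) \<inter> closed_segment (p u') (p v') = {}"
        using that by (simp add: F_def)
      from disjoint_segments_stable[OF this] obtain \<delta> where "\<delta> > 0" "stable \<delta> x"
        unfolding stable_def x by auto
      then show ?thesis
        unfolding eventually_at_right_field stable_def x by (intro exI[of _ \<delta>]) auto
    qed
    then have "\<forall>\<^sub>F \<epsilon> in at_right 0. \<forall>x\<in>F. stable \<epsilon> x"
      using eventually_ball_finite[OF \<open>finite F\<close>] by blast
    then have "\<forall>\<^sub>F \<epsilon> in at_right 0. 0 < \<epsilon> \<and> (\<forall>x\<in>F. stable \<epsilon> x)"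
      using eventually_at_right_less[of 0] by eventually_elim simp
    then obtain \<epsilon> :: real where \<epsilon>: "\<epsilon> > 0" "\<And>x. x \<in> F \<Longrightarrow> stable \<epsilon> x"
      using eventually_happens'[OF trivial_limit_at_right_real] by blast
    from general_position_perturbation[OF fin(1) \<epsilon>(1), of p] obtain q where
      near: "\<forall>v\<in>?V. dist (p v) (q v) < \<epsilon>" and
      gen: "\<forall>u\<in>?V. \<forall>v\<in>?V. \<forall>w\<in>?V. u \<noteq> v \<longrightarrow> u \<noteq> w \<longrightarrow> v \<noteq> w \<longrightarrow> orient (q u) (q v) (q w) \<noteq> 0"
      by (elim exE conjE) (rule that)
    have disj: "closed_segment (q u) (q v) \<inter> closed_segment (q u') (q v') = {}"
      if e: "{u, v} \<in> ?E" "{u', v'} \<in> ?E" "{u, v} \<inter> {u', v'} = {}" "layer {u, v} = layer {u', v'}" for u v u' v'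
    proof -
      have V: "u \<in> ?V" "v \<in> ?V" "u' \<in> ?V" "v' \<in> ?V"
        using simple_graph_tripod[of n] e by (auto simp: simple_graph_def)
      have "\<not> crossing p c {u, v} {u', v'}"
        using D e unfolding layered_drawing_def by blast
      then have "closed_segment (p u) (p v) \<inter> closed_segment (p u') (p v') = {}"
        using straight e unfolding crossing_def straight_line_def by auto
      then have "(u, v, u', v') \<in> F" using V by (simp add: F_def)
      from \<epsilon>(2)[OF this] show ?thesis using near V by (simp add: stable_def)
    qed

    define W where "W u v w = orient (q (to_nat u)) (q (to_nat v)) (q (to_nat w))" for u v w :: vertex
    define L where "L r xs = layer (leg r (xs ! 0) (xs ! 1) (xs ! 2))" for r xs
    define col where "col xs =
      (W (Base (xs ! 0)) (Base (xs ! 1)) (Base (xs ! 2)) > 0,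
       W (Apex (xs ! 0) (xs ! 1) (xs ! 2)) (Base (xs ! 3)) (Base (xs ! 4)) > 0,
       W (Apex (xs ! 0) (xs ! 1) (xs ! 2)) (Apex (xs ! 3) (xs ! 4) (xs ! 5)) (Base (xs ! 6)) > 0,
       L 0 xs mod t, L 1 xs mod t, L 2 xs mod t)" for xs
    have "\<forall>xs. col xs \<in> C" using \<open>t > 0\<close> by (simp add: col_def C_def)
    from N[OF this] obtain H where H: "H \<subseteq> {..<N}" "card H = 7" and
      hom: "\<And>xs ys. set xs \<subseteq> H \<Longrightarrow> set ys \<subseteq> H \<Longrightarrow> length xs = 7 \<Longrightarrow> ranks xs = ranks ys \<Longrightarrow> col xs = col ys"
      by blast
    define h where "h i = sorted_list_of_set H ! i" for i
    have finH: "finite H" using H finite_subset by blast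
    have h: "h i < h j" if "i < j" "j < 7" for i j
      using sorted_wrt_nth_less[OF strict_sorted_list_of_set, of i j H] that H by (simp add: h_def)
    have hH: "h i \<in> H" if "i < 7" for i
      using nth_mem[of i "sorted_list_of_set H"] that H finH by (simp add: h_def)
    then have hn: "h i < n" if "i < 7" for i using H \<open>N \<le> n\<close> that by force
    have h_eq: "h i = h j \<longleftrightarrow> i = j" if "i < 7" "j < 7" for i j
      using h[of i j] h[of j i] that by (cases i j rule: linorder_cases) auto
    have hom': "col (map h xs) = col (map h ys)"
      if "set xs \<subseteq> {..<7}" "set ys \<subseteq> {..<7}" "length xs = 7" "ranks xs = ranks ys" for xs ys
    proof (rule hom)
      have "strict_mono_on (set zs) h" if "set zs \<subseteq> {..<7}" for zs
        using h that by (auto simp: strict_mono_on_def)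
      then show "ranks (map h xs) = ranks (map h ys)"
        using that by (simp add: ranks_map_strict_mono)
    qed (use that hH in auto)

    \<comment> \<open>All base triples have the same orientation; the factor \<open>s\<close> makes
      it positive, as a reflection would.\<close>
    define s :: real where "s = (if W (Base (h 0)) (Base (h 1)) (Base (h 2)) > 0 then 1 else - 1)"
    have s: "s * s = 1" "s \<noteq> 0" by (auto simp: s_def)
    define Q where "Q u v w = s * W (relabel h u) (relabel h v) (relabel h w)" for u v w
    have relabel: "vertex_below n (relabel h v)" if "vertex_below 7 v" for v
      using that h hn by (cases v) auto
    have relabel_eq: "relabel h u = relabel h v \<longleftrightarrow> u = v" if "vertex_below 7 u" "vertex_below 7 v" for u v
      using that by (cases u; cases v) (auto simp: h_eq)
    have Q0: "Q u v w \<noteq> 0" if "vertex_below 7 u" "vertex_below 7 v" "vertex_below 7 w" "distinct [u, v, w]" for u v w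
    proof -
      have "to_nat (relabel h x) \<in> ?V" if "vertex_below 7 x" for x
        using relabel[OF that] by (auto simp: tripod_V_def)
      then show ?thesis
        unfolding Q_def W_def using gen that relabel_eq s by (auto simp: relabel_eq)
    qed
    \<comment> \<open>For \<open>s = - 1\<close> positivity of \<open>Q\<close> is the negation of
      positivity of \<open>W\<close> only because general position excludes zero.\<close>
    have sgn: "0 < Q u v w \<longleftrightarrow> (if s = 1 then 0 < W (relabel h u) (relabel h v) (relabel h w)
        else \<not> 0 < W (relabel h u) (relabel h v) (relabel h w))"
      if "vertex_below 7 u" "vertex_below 7 v" "vertex_below 7 w" "distinct [u, v, w]" for u v w
      using Q0[OF that] by (auto simp: Q_def s_def)
    have same_layer: "layer (leg r (h i) (h j) (h k)) = layer (leg r (h i') (h j') (h k'))"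
      if "r < 3" "i < j" "j < k" "k < 7" "i' < j'" "j' < k'" "k' < 7" for r i j k i' j' k'
    proof -
      have "col (map h [i, j, k, i, i, i, i]) = col (map h [i', j', k', i', i', i', i'])"
        using that by (intro hom') (auto simp: ranks_def)
      moreover have "layer (leg r (h i) (h j) (h k)) < t" "layer (leg r (h i') (h j') (h k')) < t"
        using that h hn by (auto intro!: layer_lt leg_in_tripod_E)
      ultimately show ?thesis using less_3_cases[OF \<open>r < 3\<close>]
        by (auto simp: col_def L_def)
    qed
    \<comment> \<open>If both equalities failed, the two legs would cross by
      \<open>segments_meet_if_orient_alternate\<close>. But they lie in the same layer and have no
      common endpoint, so \<open>disj\<close> applies.\<close>
    have nocross: "(0 < Q a u b) = (0 < Q a u v) \<or> (0 < Q b v a) = (0 < Q b v u)"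
      if r: "r < 3" and u: "u = Apex i j k" "i < j" "j < k" "k < 7" and v: "v = Apex i' j' k'" "i' < j'" "j' < k'" "k' < 7"
       and ab: "a = Base (foot r i j k)" "b = Base (foot r i' j' k')" "foot r i j k \<noteq> foot r i' j' k'"
      for r i j k i' j' k' a b u v
    proof (rule ccontr)
      assume neg: "\<not> ?thesis"
      have below: "vertex_below 7 x" if "x \<in> {a, b, u, v}" for x
        using that u v ab less_3_cases[OF r] by auto
      have "i \<noteq> i' \<or> j \<noteq> j' \<or> k \<noteq> k'" using ab by auto
      then have dist: "distinct [a, b, u, v]" using u v ab by auto
      let ?q = "\<lambda>x. q (to_nat (relabel h x))"
      have ne: "Q a u b \<noteq> 0" "Q a u v \<noteq> 0" "Q b v a \<noteq> 0" "Q b v u \<noteq> 0"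
        using Q0 below dist by auto
      have "Q a u b * Q a u v < 0" "Q b v a * Q b v u < 0"
        using neg ne by (auto simp: mult_less_0_iff)
      moreover have "Q x y z * Q x y z' = orient (?q x) (?q y) (?q z) * orient (?q x) (?q y) (?q z')" for x y z z'
        using s(1) by (simp add: Q_def W_def algebra_simps)
      ultimately have "closed_segment (?q a) (?q u) \<inter> closed_segment (?q b) (?q v) \<noteq> {}"
        by (intro segments_meet_if_orient_alternate) auto
      moreover have "closed_segment (?q a) (?q u) \<inter> closed_segment (?q b) (?q v) = {}"
      proof (rule disj)
        have h_foot: "foot r (h x) (h y) (h z) = h (foot r x y z)" for x y z
          using less_3_cases[OF r] by auto
        have e: "{to_nat (relabel h a), to_nat (relabel h u)} = leg r (h i) (h j) (h k)"
          "{to_nat (relabel h b), to_nat (relabel h v)} = leg r (h i') (h j') (h k')"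
          using u v ab by (auto simp: leg_def h_foot)
        show "{to_nat (relabel h a), to_nat (relabel h u)} \<in> ?E" "{to_nat (relabel h b), to_nat (relabel h v)} \<in> ?E"
          unfolding e using h hn r u v by (auto intro!: leg_in_tripod_E)
        show "layer {to_nat (relabel h a), to_nat (relabel h u)} = layer {to_nat (relabel h b), to_nat (relabel h v)}"
          unfolding e using same_layer r u v by blast
        show "{to_nat (relabel h a), to_nat (relabel h u)} \<inter> {to_nat (relabel h b), to_nat (relabel h v)} = {}"
          using dist below by (auto simp: relabel_eq)
      qed
      ultimately show False by blast
    qed
    have base: "0 < Q (Base i) (Base j) (Base k)" if "i < j" "j < k" "k < 7" for i j k
    proof -
      have "col (map h [i, j, k, i, i, i, i]) = col (map h [0, 1, 2, 0, 0, 0, 0])"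
        using that by (intro hom') (auto simp: ranks_def)
      then have "(0 < W (Base (h i)) (Base (h j)) (Base (h k))) = (s = 1)"
        by (simp add: col_def s_def)
      then show ?thesis using that by (subst sgn) auto
    qed
    show False
    proof (rule no_order_invariant_tripods[of "\<lambda>u v w. 0 < Q u v w"])
      fix a b c d e
      show "(0 < Q a b c) = (0 < Q b c a)"
        unfolding Q_def W_def by (subst orient_rotate) (rule refl)
      assume *: "vertex_below 7 a" "vertex_below 7 b" "vertex_below 7 c"
      show "(0 < Q a c b) = (\<not> 0 < Q a b c)" if "distinct [a, b, c]"
      proof -
        have "Q a c b = - Q a b c"
          unfolding Q_def W_def by (subst orient_swap) simp
        then show ?thesis using Q0[of a b c] * that by linarith
      qed
      assume *: "vertex_below 7 a" "vertex_below 7 b" "vertex_below 7 c" "vertex_below 7 d" "vertex_below 7 e"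
      show "\<not> ((0 < Q a b c) = (0 < Q a d e) \<and> (0 < Q a b d) \<noteq> (0 < Q a c e) \<and> (0 < Q a b e) = (0 < Q a c d)) \<and>
        ((0 < Q a b c) = (0 < Q a d e) \<or> (0 < Q a b d) \<noteq> (0 < Q a c e) \<or> (0 < Q a b e) = (0 < Q a c d))"
        if dist: "distinct [a, b, c, d, e]"
      proof -
        have "Q a b c * Q a d e - Q a b d * Q a c e + Q a b e * Q a c d = s * s * 0"
          unfolding orient_Grassmann_Pluecker[of "q (to_nat (relabel h a))" "q (to_nat (relabel h b))"
             "q (to_nat (relabel h c))" "q (to_nat (relabel h d))" "q (to_nat (relabel h e))", symmetric]
          by (simp add: Q_def W_def algebra_simps)
        \<comment> \<open>Three nonzero terms of equal sign could not add up to zero.\<close>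
        moreover have "Q a b c \<noteq> 0" "Q a d e \<noteq> 0" "Q a b d \<noteq> 0" "Q a c e \<noteq> 0" "Q a b e \<noteq> 0" "Q a c d \<noteq> 0"
          using Q0 * dist by auto
        moreover have "0 < x * y \<longleftrightarrow> (0 < x) = (0 < y)" "x * y < 0 \<longleftrightarrow> (0 < x) \<noteq> (0 < y)"
          if "x \<noteq> 0" "y \<noteq> 0" for x y :: real
          using that by (auto simp: zero_less_mult_iff mult_less_0_iff)
        ultimately show ?thesis by (smt (verit))
      qed
    next
      show "0 < Q (Base i) (Base j) (Base k)" if "i < j" "j < k" "k < 7" for i j k
        using base that .
    next
      fix i j k x y i' j' k' x' y' :: nat
      assume *: "i < j" "j < k" "k < 7" "x < y" "y < 7" "i' < j'" "j' < k'" "k' < 7" "x' < y'" "y' < 7"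
        and r: "ranks [i, j, k, x, y] = ranks [i', j', k', x', y']"
      \<comment> \<open>Both lists are padded to length seven by repeating the entry at position
        3.\<close>
      have "ranks [i, j, k, x, y, x, x] = ranks [i', j', k', x', y', x', x']"
        using r ranks_snoc_nth[of 3 "[i, j, k, x, y]"] ranks_snoc_nth[of 3 "[i, j, k, x, y, x]"]
          ranks_snoc_nth[of 3 "[i', j', k', x', y']"] ranks_snoc_nth[of 3 "[i', j', k', x', y', x']"]
        by simp
      then have "col (map h [i, j, k, x, y, x, x]) = col (map h [i', j', k', x', y', x', x'])"
        using * by (intro hom') auto
      then show "(0 < Q (Apex i j k) (Base x) (Base y)) = (0 < Q (Apex i' j' k') (Base x') (Base y'))"
        using * by (simp add: sgn) (simp add: col_def)
    next
      fix i j k l m n x i' j' k' l' m' n' x' :: nat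
      assume *: "i < j" "j < k" "k < 7" "l < m" "m < n" "n < 7" "x < 7" "i < l"
          "i' < j'" "j' < k'" "k' < 7" "l' < m'" "m' < n'" "n' < 7" "x' < 7" "i' < l'"
        and r: "ranks [i, j, k, l, m, n, x] = ranks [i', j', k', l', m', n', x']"
      have "col (map h [i, j, k, l, m, n, x]) = col (map h [i', j', k', l', m', n', x'])"
        using * r by (intro hom') auto
      then show "(0 < Q (Apex i j k) (Apex l m n) (Base x)) = (0 < Q (Apex i' j' k') (Apex l' m' n') (Base x'))"
        using * by (simp add: sgn) (simp add: col_def)
    next
      fix r i j k l m n :: nat
      assume *: "r < 3" "i < j" "j < k" "k < 7" "l < m" "m < n" "n < 7" "foot r i j k \<noteq> foot r l m n"
      show "(0 < Q (Base (foot r i j k)) (Apex i j k) (Base (foot r l m n))) =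
          (0 < Q (Base (foot r i j k)) (Apex i j k) (Apex l m n)) \<or>
          (0 < Q (Base (foot r l m n)) (Apex l m n) (Base (foot r i j k))) =
          (0 < Q (Base (foot r l m n)) (Apex l m n) (Apex i j k))"
        using nocross[OF *(1) refl *(2-4) refl *(5-7) refl refl *(8)] .
    qed
  qed
qed

theorem theorem1:
  fixes t :: nat
  assumes "t > 0"
  shows "\<exists>(V :: nat set) (E :: nat set set).
           simple_graph V E \<and> thickness V E = 3 \<and> geometric_thickness V E \<ge> t"
proof -
  obtain N1 where N1: "\<forall>n\<ge>N1. \<forall>k\<le>2. \<forall>p c layer. \<not> layered_drawing (tripod_V n) (tripod_E n) k p c layer"
    using tripod_two_layers_impossible by blast
  obtain N2 where N2: "\<forall>n\<ge>N2. \<forall>m\<le>t. \<forall>p c layer.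
    \<not> (layered_drawing (tripod_V n) (tripod_E n) m p c layer \<and> straight_line (tripod_E n) p c)"
    using tripod_straight_impossible[OF assms] by blast
  define n where "n = max N1 N2"
  let ?K = "{k. \<exists>p c layer. layered_drawing (tripod_V n) (tripod_E n) k p c layer}"
  have "3 \<in> ?K" using tripod_three_layers by blast
  moreover have "3 \<le> k" if "k \<in> ?K" for k
  proof (rule ccontr)
    assume "\<not> 3 \<le> k"
    then have "k \<le> 2" by simp
    then show False using N1 that by (auto simp: n_def)
  qed
  ultimately have "Inf ?K = 3" by (intro cInf_eq_minimum) auto
  moreover have "t \<le> geometric_thickness (tripod_V n) (tripod_E n)"
  proof (rule ccontr)
    assume "\<not> ?thesis"
    \<comment> \<open>The value is attained by a drawing, so a value below \<open>t\<close>
      contradicts the choice of \<open>N2\<close>; this also excludes the default value 0 of an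
      empty infimum.\<close>
    then show False
      using geometric_thickness_attained[OF simple_graph_tripod, of n] N2 by (auto simp: n_def)
  qed
  ultimately show ?thesis
    using simple_graph_tripod[of n] by (auto simp: thickness_def)
qed

end
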